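(* Let $r,s\geq 1$ be integers with $rs\geq 2$, let $r^s$ denote the rectangular partition with $s$ parts all equal to $r$, and let $\nu=(r^{s-1},r-1)$ be the partition obtained from $r^s$ by removing its unique corner cell (i.e. $s-1$ parts equal to $r$ and one part equal to $r-1$, the latter omitted if $r=1$). If $\dim \mathbf{M}_{\nu}=(rs-1)!$, then $\dim\mathbf{M}_{r^s}=(rs)!$. Moreover, $$\partial_{p_1}C_{r^s}(x;q,t)=B_{r^s}(q,t)\,C_{\nu}(x;q,t),\qquad G_{r^s}(q,t)=B_{r^s}(q,t)\,G_{\nu}(q,t).$$
   Context: Partitions are drawn in French convention: the partition $\mu=(\mu_1\geq\mu_2\geq\cdots)$ has $\mu_i$ cells in its $i$-th row counted from the bottom; cell $(i,j)$ is the $j$-th cell of row $i$ ($i,j\geq1$). For $\mu\vdash N$, list the pairs $(i-1,j-1)$, $(i,j)\in\mu$, in lexicographic order as $(p_1,q_1),\dots,(p_N,q_N)$ and set $\Delta_\mu(x,y)=\det\|x_a^{p_b}y_a^{q_b}\|_{a,b=1}^N$, a polynomial in $x_1,\dots,x_N,y_1,\dots,y_N$. Let $\mathbf{M}_\mu$ be the linear span (over $\mathbb{Q}$) of all partial derivatives $\partial_x^{p}\partial_y^{q}\Delta_\mu$ of all orders (including $\Delta_\mu$ itself). $S_N$ acts diagonally, $\sigma P(x_1,\dots,x_N;y_1,\dots,y_N)=P(x_{\sigma_1},\dots,x_{\sigma_N};y_{\sigma_1},\dots,y_{\sigma_N})$, and $\mathbf{M}_\mu$ is invariant. Let $\mathcal{H}_{h,k}(\mathbf{M}_\mu)$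 be the subspace of elements bihomogeneous of degree $h$ in $x$ and $k$ in $y$. The bigraded Frobenius characteristic is $C_\mu(x;q,t)=\sum_{h,k}t^hq^k\,\mathcal{F}(\mathrm{char}\,\mathcal{H}_{h,k}(\mathbf{M}_\mu))$ where for a character $\chi$ of $S_N$, $\mathcal{F}(\chi)=\frac1{N!}\sum_{\sigma\in S_N}\chi(\sigma)p_{\lambda(\sigma)}$ with $p_\lambda$ the power sum symmetric function indexed by the cycle type. $\partial_{p_1}$ denotes partial differentiation with respect to $p_1$ when a symmetric function is written as a polynomial in the power sums $p_1,p_2,\dots$; $G_\mu(q,t)=\partial_{p_1}^N C_\mu(x;q,t)$ (the bigraded Hilbert series of $\mathbf{M}_\mu$). Finally $B_\mu(q,t)=\sum_{(i,j)\in\mu}t^{i-1}q^{j-1}$. *)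

theory Defs
  imports
    "HOL-Library.Poly_Mapping"
    "HOL-Library.Multiset"
    "HOL-Combinatorics.Orbits"
    "Jordan_Normal_Form.Determinant"
begin

section \<open>Multivariate polynomials over the rationals\<close>

type_synonym 'v mpoly = "('v \<Rightarrow>\<^sub>0 nat) \<Rightarrow>\<^sub>0 rat"

definition Const :: "rat \<Rightarrow> 'v mpoly" where
  "Const c = Poly_Mapping.single 0 c"

definition Var :: "'v \<Rightarrow> 'v mpoly" where
  "Var v = Poly_Mapping.single (Poly_Mapping.single v 1) 1"

definition mscale :: "rat \<Rightarrow> 'v mpoly \<Rightarrow> 'v mpoly" where
  "mscale c P = Const c * P"

global_interpretation mp: Vector_Spaces.vector_space mscale
  by unfold_locales
    (simp_all add: mscale_def Const_def algebra_simps single_add mult_single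
      flip: mult.assoc)

text \<open>The subtraction of exponents truncates only on monomials not containing \<open>v\<close>,
  whose terms vanish because of the factor \<open>lookup m v\<close>.\<close>

definition partial_deriv :: "'v \<Rightarrow> 'v mpoly \<Rightarrow> 'v mpoly" where
  "partial_deriv v P =
     (\<Sum>m\<in>Poly_Mapping.keys P.
        Poly_Mapping.single (m - Poly_Mapping.single v 1)
          (of_nat (Poly_Mapping.lookup m v) * Poly_Mapping.lookup P m))"

definition substitute :: "('v \<Rightarrow> 'w mpoly) \<Rightarrow> 'v mpoly \<Rightarrow> 'w mpoly" where
  "substitute f P =
     (\<Sum>m\<in>Poly_Mapping.keys P.
        Const (Poly_Mapping.lookup P m) *
        (\<Prod>v\<in>Poly_Mapping.keys m. f v ^ Poly_Mapping.lookup m v))"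

text \<open>The trace of a linear endomorphism \<open>f\<close> of a finite-dimensional subspace \<open>W\<close>; it does not
  depend on the chosen basis.\<close>

definition trace_on :: "'v mpoly set \<Rightarrow> ('v mpoly \<Rightarrow> 'v mpoly) \<Rightarrow> rat" where
  "trace_on W f =
     (let B = (SOME B. B \<subseteq> W \<and> mp.independent B \<and> W \<subseteq> mp.span B)
      in \<Sum>b\<in>B. mp.representation B (f b) b)"


section \<open>Partitions\<close>

text \<open>A partition is the list of its nonzero parts in weakly decreasing order.\<close>

definition rectangle :: "nat \<Rightarrow> nat \<Rightarrow> nat list" where
  "rectangle r s = replicate s r"

definition rectangle_minus_corner :: "nat \<Rightarrow> nat \<Rightarrow> nat list" where
  "rectangle_minus_corner r s = replicate (s - 1) r @ (if r = 1 then [] else [r - 1])"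

text \<open>The pairs \<open>(i - 1, j - 1)\<close> for the cells \<open>(i, j)\<close> of the diagram, in lexicographic order.\<close>

definition biexponents :: "nat list \<Rightarrow> (nat \<times> nat) list" where
  "biexponents \<mu> = [(p, q). p \<leftarrow> [0..<length \<mu>], q \<leftarrow> [0..<\<mu> ! p]]"


section \<open>The modules\<close>

text \<open>Indices start at \<open>0\<close>: for a partition of \<open>N\<close>, the variables
  \<open>x\<^sub>1, \<dots>, x\<^sub>N, y\<^sub>1, \<dots>, y\<^sub>N\<close> are \<open>X 0, \<dots>, X (N - 1), Y 0, \<dots>, Y (N - 1)\<close>,
  and the symmetric group consists of the permutations of \<open>{..<N}\<close>.\<close>

datatype xyvar = X nat | Y nat

definition lattice_det :: "nat list \<Rightarrow> xyvar mpoly" where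
  "lattice_det \<mu> =
     det (mat (sum_list \<mu>) (sum_list \<mu>)
       (\<lambda>(a, b). Var (X a) ^ fst (biexponents \<mu> ! b) * Var (Y a) ^ snd (biexponents \<mu> ! b)))"

text \<open>Partial derivatives commute, so the derivatives \<open>\<partial>\<^sub>x\<^sup>p \<partial>\<^sub>y\<^sup>q\<close> are exactly the iterated ones
  along finite lists of variables; the empty list gives the determinant itself.\<close>

definition deriv_module :: "nat list \<Rightarrow> xyvar mpoly set" where
  "deriv_module \<mu> =
     mp.span {fold partial_deriv vs (lattice_det \<mu>) |vs.
       set vs \<subseteq> X ` {..<sum_list \<mu>} \<union> Y ` {..<sum_list \<mu>}}"

definition xdegree :: "(xyvar \<Rightarrow>\<^sub>0 nat) \<Rightarrow> nat" where
  "xdegree m = (\<Sum>v\<in>Poly_Mapping.keys m. case v of X _ \<Rightarrow> Poly_Mapping.lookup m v | Y _ \<Rightarrow> 0)"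

definition ydegree :: "(xyvar \<Rightarrow>\<^sub>0 nat) \<Rightarrow> nat" where
  "ydegree m = (\<Sum>v\<in>Poly_Mapping.keys m. case v of X _ \<Rightarrow> 0 | Y _ \<Rightarrow> Poly_Mapping.lookup m v)"

definition bihomogeneous :: "nat \<Rightarrow> nat \<Rightarrow> xyvar mpoly \<Rightarrow> bool" where
  "bihomogeneous h k P \<longleftrightarrow> (\<forall>m\<in>Poly_Mapping.keys P. xdegree m = h \<and> ydegree m = k)"

definition bihom_part :: "nat \<Rightarrow> nat \<Rightarrow> xyvar mpoly set \<Rightarrow> xyvar mpoly set" where
  "bihom_part h k W = {P \<in> W. bihomogeneous h k P}"

definition diag_action :: "(nat \<Rightarrow> nat) \<Rightarrow> xyvar mpoly \<Rightarrow> xyvar mpoly" where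
  "diag_action \<sigma> = substitute (\<lambda>v. case v of X i \<Rightarrow> Var (X (\<sigma> i)) | Y i \<Rightarrow> Var (Y (\<sigma> i)))"

definition bichar :: "nat list \<Rightarrow> nat \<Rightarrow> nat \<Rightarrow> (nat \<Rightarrow> nat) \<Rightarrow> rat" where
  "bichar \<mu> h k \<sigma> = trace_on (bihom_part h k (deriv_module \<mu>)) (diag_action \<sigma>)"


section \<open>Symmetric functions and the Frobenius characteristic\<close>

text \<open>Power sums are algebraically independent generators of the ring of symmetric functions over
  \<open>\<rat>\<close>, so symmetric functions with coefficients in \<open>\<rat>[q, t]\<close> are represented as elements of the
  polynomial ring \<open>\<rat>[q, t, p\<^sub>1, p\<^sub>2, \<dots>]\<close>, and \<open>\<rat>[q, t]\<close> as the subring of elements without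
  power sums. \<open>PSum k\<close> stands for \<open>p\<^sub>k\<close> with \<open>k \<ge> 1\<close>; \<open>PSum 0\<close> never occurs.\<close>

datatype symvar = QVar | TVar | PSum nat

definition cycle_type :: "nat \<Rightarrow> (nat \<Rightarrow> nat) \<Rightarrow> nat multiset" where
  "cycle_type N \<sigma> = image_mset card (mset_set (orbit \<sigma> ` {..<N}))"

definition power_sum :: "nat multiset \<Rightarrow> symvar mpoly" where
  "power_sum \<rho> = (\<Prod>k\<in>#\<rho>. Var (PSum k))"

definition frobenius :: "nat \<Rightarrow> ((nat \<Rightarrow> nat) \<Rightarrow> rat) \<Rightarrow> symvar mpoly" where
  "frobenius N \<chi> =
     mscale (1 / fact N) (\<Sum>\<sigma> | \<sigma> permutes {..<N}. mscale (\<chi> \<sigma>) (power_sum (cycle_type N \<sigma>)))"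

text \<open>Only finitely many bihomogeneous components are nonzero, so that \<^const>\<open>Sum_any\<close> is the
  intended sum over all \<open>h, k\<close>.\<close>

definition frob_char :: "nat list \<Rightarrow> symvar mpoly" where
  "frob_char \<mu> =
     Sum_any (\<lambda>(h, k). Var TVar ^ h * Var QVar ^ k * frobenius (sum_list \<mu>) (bichar \<mu> h k))"

definition hilbert_series :: "nat list \<Rightarrow> symvar mpoly" where
  "hilbert_series \<mu> = (partial_deriv (PSum 1) ^^ sum_list \<mu>) (frob_char \<mu>)"

definition biexponent_gen :: "nat list \<Rightarrow> symvar mpoly" where
  "biexponent_gen \<mu> = (\<Sum>(p, q)\<leftarrow>biexponents \<mu>. Var TVar ^ p * Var QVar ^ q)"

end

theory Submission
  imports Defs "HOL-Combinatorics.Stirling"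
begin

text \<open>Put \<open>N = r s\<close>, \<open>n = N - 1\<close>, \<open>\<mu> = r\<^sup>s\<close>, and let \<open>D\<^sub>c\<close> be the operator \<open>\<partial>\<^sub>x\<^sup>a \<partial>\<^sub>y\<^sup>b\<close> in the last pair of
  variables, for a cell \<open>c = (a, b)\<close>. For the corner cell, which exists and is unique because \<open>\<mu>\<close> is a rectangle,
  \<open>D\<^sub>c \<Delta>\<^sub>\<mu>\<close> is a nonzero multiple of \<open>\<Delta>\<^sub>\<nu>\<close>, and \<open>D\<^sub>c\<close> kills \<open>\<Delta>\<^sub>\<mu>\<close> for \<open>c\<close> outside \<open>\<mu>\<close>. Filter \<open>M\<^sub>\<mu>\<close> by the
  subspaces killed by \<open>D\<^sub>c\<close> for all but the lexicographically first \<open>k\<close> cells \<open>c\<close>. Then \<open>D\<^sub>c\<close> embeds the quotient of two successive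
  subspaces as a space containing \<open>M\<^sub>\<nu>\<close>, so that \<open>dim M\<^sub>\<mu> \<ge> N dim M\<^sub>\<nu> = N!\<close>.

  Conversely \<open>dim M\<^sub>\<mu> \<le> N!\<close>: the alternating sum of a polynomial over the \<open>S\<^sub>N\<close>-orbit of the point whose
  coordinates are the cells of \<open>\<mu>\<close> has the pairing with \<open>\<Delta>\<^sub>\<mu>\<close> by differentiation as its part of lowest degree.
  Hence differential operators producing a basis of \<open>M\<^sub>\<mu>\<close> from \<open>\<Delta>\<^sub>\<mu>\<close> restrict to linearly independent
  functions on this orbit of \<open>N!\<close> points.

  So the successive quotients are exactly \<open>M\<^sub>\<nu>\<close>, shifted in bidegree by \<open>c\<close>. The operators commute with \<open>S\<^sub>n\<close>, so
  additivity of the trace yields the restriction of the bigraded character to \<open>S\<^sub>n\<close>, and \<open>\<partial>\<close> with respect to \<open>p\<^sub>1\<close> is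
  restriction from \<open>S\<^sub>N\<close> to \<open>S\<^sub>n\<close> on Frobenius characteristics.\<close>

section \<open>Traces of linear endomorphisms\<close>

abbreviation mlinear :: "('v mpoly \<Rightarrow> 'w mpoly) \<Rightarrow> bool" where
  "mlinear \<equiv> Vector_Spaces.linear mscale mscale"

global_interpretation mpp: vector_space_pair "mscale :: rat \<Rightarrow> 'v mpoly \<Rightarrow> _" "mscale :: rat \<Rightarrow> 'w mpoly \<Rightarrow> _" ..

lemma mlinearI:
  assumes "\<And>P Q. f (P + Q) = f P + f Q" "\<And>c P. f (mscale c P) = mscale c (f P)"
  shows "mlinear f"
  using assms by (simp add: Vector_Spaces.linear_iff mp.vector_space_axioms)

lemma representation_linear_image:
  assumes B: "mp.independent B" "finite B" and A: "mp.independent A" and f: "mlinear f"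
    and fB: "f ` B \<subseteq> mp.span A" and x: "x \<in> mp.span B"
  shows "mp.representation A (f x) a = (\<Sum>b\<in>B. mp.representation B x b * mp.representation A (f b) a)"
proof -
  have "f x = f (\<Sum>b\<in>B. mscale (mp.representation B x b) b)"
    using B x by (simp add: mp.sum_representation_eq)
  also have "\<dots> = (\<Sum>b\<in>B. mscale (mp.representation B x b) (f b))"
    using f by (simp add: mpp.linear_sum mpp.linear_scale)
  finally show ?thesis
    using A fB by (simp add: mp.representation_sum mp.representation_scale mp.span_scale image_subset_iff)
qed

text \<open>This is tr(PQ) = tr(QP), with P the mixed matrix of \<open>f\<close> from
  \<open>C\<close>-coordinates to \<open>B\<close>-coordinates and Q the change of basis from
  \<open>B\<close> to \<open>C\<close>.\<close>

lemma trace_basis_unique: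
  assumes B: "mp.independent B" "finite B" and C: "mp.independent C" "finite C"
    and eq: "mp.span B = mp.span C" and f: "mlinear f" and inv: "f ` mp.span B \<subseteq> mp.span B"
  shows "(\<Sum>b\<in>B. mp.representation B (f b) b) = (\<Sum>c\<in>C. mp.representation C (f c) c)"
proof -
  have fB: "f ` B \<subseteq> mp.span B" and fC: "f ` C \<subseteq> mp.span B"
    using inv eq mp.span_superset[of B] mp.span_superset[of C]
    by (metis image_mono order_trans)+
  have "(\<Sum>b\<in>B. mp.representation B (f b) b)
      = (\<Sum>b\<in>B. \<Sum>c\<in>C. mp.representation C b c * mp.representation B (f c) b)"
    by (intro sum.cong refl representation_linear_image[OF C B(1) f fC]) (simp add: mp.span_base flip: eq)
  also have "\<dots> = (\<Sum>c\<in>C. \<Sum>b\<in>B. mp.representation B (f c) b * mp.representation C b c)"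
    by (subst sum.swap) (simp add: mult.commute)
  also have "\<dots> = (\<Sum>c\<in>C. mp.representation C (f c) c)"
  proof (intro sum.cong refl)
    fix c assume "c \<in> C"
    hence "f c \<in> mp.span B" using fC by auto
    then show "(\<Sum>b\<in>B. mp.representation B (f c) b * mp.representation C b c) = mp.representation C (f c) c"
      using representation_linear_image[OF B C(1) mp.linear_ident, of "f c" c]
        mp.span_superset[of B] by (simp add: eq)
  qed
  finally show ?thesis .
qed

text \<open>\<open>mp.dim\<close> is the cardinality of a basis, hence 0 in infinite dimension, so
  finiteness is carried separately. The spanning set may lie outside \<open>W\<close>, which makes
  the passage to subsets immediate.\<close>

definition finite_dim :: "'v mpoly set \<Rightarrow> bool" where
  "finite_dim W \<longleftrightarrow> (\<exists>S. finite S \<and> W \<subseteq> mp.span S)"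

lemma finite_dim_subset: "finite_dim W \<Longrightarrow> V \<subseteq> W \<Longrightarrow> finite_dim V"
  unfolding finite_dim_def by blast

lemma finite_dim_image: "finite_dim W \<Longrightarrow> mlinear f \<Longrightarrow> finite_dim (f ` W)"
  unfolding finite_dim_def by (meson finite_imageI mpp.linear_spans_image)

lemma finite_dim_independent:
  "finite_dim W \<Longrightarrow> B \<subseteq> W \<Longrightarrow> mp.independent B \<Longrightarrow> finite B"
  unfolding finite_dim_def by (meson mp.independent_span_bound order_trans)

lemma trace_on_basis:
  assumes B: "B \<subseteq> W" "mp.independent B" "W \<subseteq> mp.span B"
    and W: "finite_dim W" "mp.subspace W" and f: "mlinear f" and inv: "f ` W \<subseteq> W"
  shows "trace_on W f = (\<Sum>b\<in>B. mp.representation B (f b) b)"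
proof -
  define C where "C = (SOME B. B \<subseteq> W \<and> mp.independent B \<and> W \<subseteq> mp.span B)"
  have C: "C \<subseteq> W" "mp.independent C" "W \<subseteq> mp.span C"
    using someI[of "\<lambda>B. B \<subseteq> W \<and> mp.independent B \<and> W \<subseteq> mp.span B" B] B
    unfolding C_def by auto
  have "mp.span B = W" "mp.span C = W"
    using B C W(2) mp.span_subspace by blast+
  then show ?thesis
    unfolding trace_on_def C_def[symmetric] Let_def
    using B C W f inv finite_dim_independent by (intro trace_basis_unique) auto
qed

text \<open>A basis \<open>C\<close> of the kernel of \<open>h\<close> on \<open>W\<close> is
  extended to a basis \<open>B\<close> of \<open>W\<close>. In \<open>B\<close> the map
  \<open>f\<close> is block triangular, and \<open>h\<close> carries the complement \<open>D\<close>
  of \<open>C\<close> to a basis of the image, where \<open>g\<close> has the second diagonal block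
  as its matrix.\<close>

lemma trace_on_exact:
  assumes W: "mp.subspace W" "finite_dim W" and f: "mlinear f" "f ` W \<subseteq> W"
    and g: "mlinear g" and h: "mlinear h"
    and comm: "\<And>w. w \<in> W \<Longrightarrow> h (f w) = g (h w)"
  shows "trace_on W f = trace_on {w \<in> W. h w = 0} f + trace_on (h ` W) g"
proof -
  define K where "K = {w \<in> W. h w = 0}"
  have K: "mp.subspace K" "finite_dim K" "f ` K \<subseteq> K"
    using W(1) mpp.linear_subspace_kernel[OF h] mp.subspace_inter[of W "{x. h x = 0}"] f(2) comm
      mpp.linear_0[OF g] finite_dim_subset[OF W(2), of K]
    by (auto simp: K_def Collect_conj_eq)
  obtain C where C: "C \<subseteq> K" "mp.independent C" "K \<subseteq> mp.span C"
    using mp.maximal_independent_subset by blast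
  have KC: "mp.span C = K" using C K mp.span_subspace by blast
  obtain B where B: "C \<subseteq> B" "B \<subseteq> W" "mp.independent B" "W \<subseteq> mp.span B"
    using mp.maximal_independent_subset_extend[of C W] C by (auto simp: K_def)
  have WB: "mp.span B = W" using B W mp.span_subspace by blast
  have fin: "finite B" "finite C"
    using finite_dim_independent W K B C by blast+
  define D where "D = B - C"
  have D: "D \<subseteq> B" "finite D" "mp.independent D" "B = C \<union> D" "C \<inter> D = {}"
    using fin B mp.independent_mono unfolding D_def by blast+
  have inj: "inj_on h (mp.span D)"
  proof (subst mpp.linear_inj_on_iff_eq_0[OF h], simp, intro ballI impI)
    fix x assume x: "x \<in> mp.span D" "h x = 0"
    have "x \<in> W" using x D WB mp.span_mono by blast
    \<comment> \<open>The \<open>B\<close>-coordinates of \<open>x\<close> are then supported both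
      in \<open>C\<close> and in \<open>D\<close>, which are disjoint.\<close>
    hence "x \<in> mp.span C" using x KC by (simp add: K_def)
    hence "mp.representation B x = mp.representation C x"
      using mp.representation_extend B by blast
    moreover have "mp.representation B x = mp.representation D x"
      using mp.representation_extend[OF B(3) x(1)] D by blast
    ultimately have "mp.representation B x b = 0" if "b \<in> B" for b
      using mp.representation_ne_zero[of C x b] mp.representation_ne_zero[of D x b] D(5) by force
    moreover have "x = (\<Sum>b\<in>B. mscale (mp.representation B x b) b)"
      using mp.sum_representation_eq[OF B(3), of x B] \<open>x \<in> W\<close> B fin by auto
    ultimately show "x = 0" by simp
  qed
  hence injD: "inj_on h D" using inj_on_subset mp.span_superset by blast
  have iA: "mp.independent (h ` D)"
    using mpp.linear_independent_injective_image[OF h D(3) inj] .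
  have hC: "h c = 0" if "c \<in> C" for c using that C by (auto simp: K_def)
  have A_span: "h ` W \<subseteq> mp.span (h ` D)"
  proof -
    have "h ` B \<subseteq> mp.span (h ` D)"
      using D(4) hC mp.span_zero mp.span_base[of _ "h ` D"] by auto
    thus ?thesis
      using WB mpp.linear_span_image[OF h, of B] mp.span_minimal[of "h ` B"] by simp
  qed
  have hW: "mp.subspace (h ` W)" "finite_dim (h ` W)"
    using mpp.linear_subspace_image[OF h W(1)] finite_dim_image[OF W(2) h] .
  have ghW: "g ` h ` W \<subseteq> h ` W"
  proof (intro image_subsetI, elim imageE, hypsubst)
    fix w assume "w \<in> W"
    thus "g (h w) \<in> h ` W" using f(2) comm[of w] by (metis image_eqI image_subset_iff)
  qed
  have trA: "trace_on (h ` W) g = (\<Sum>d\<in>D. mp.representation (h ` D) (g (h d)) (h d))"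
    using trace_on_basis[OF image_mono[OF subset_trans[OF D(1) B(2)]] iA A_span hW(2,1) g ghW]
    by (simp add: sum.reindex[OF injD])
  \<comment> \<open>Applying \<open>h\<close> to the expansion of \<open>f d\<close> in
    \<open>B\<close> deletes the \<open>C\<close>-terms and keeps the \<open>D\<close>-coordinates,
    so the diagonal entries coincide.\<close>
  have "mp.representation (h ` D) (g (h d)) (h d) = mp.representation B (f d) d" if d: "d \<in> D" for d
  proof -
    have dW: "d \<in> W" "f d \<in> W" using d D(1) B(2) f(2) by auto
    have "mp.representation (h ` D) (h (f d)) (h d)
      = (\<Sum>b\<in>B. mp.representation B (f d) b * mp.representation (h ` D) (h b) (h d))"
      using B fin iA h A_span dW WB by (intro representation_linear_image) auto
    also have "\<dots> = (\<Sum>b\<in>B. if b = d then mp.representation B (f d) b else 0)"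
    proof (intro sum.cong refl)
      fix b assume b: "b \<in> B"
      show "mp.representation B (f d) b * mp.representation (h ` D) (h b) (h d)
        = (if b = d then mp.representation B (f d) b else 0)"
      proof (cases "b \<in> C")
        case True
        then show ?thesis using hC[OF True] D(5) d by (auto simp: mp.representation_zero)
      next
        case False
        hence "b \<in> D" using b D by auto
        moreover from this have "h b = h d \<longleftrightarrow> b = d" using injD d by (auto simp: inj_on_def)
        ultimately show ?thesis
          using mp.representation_basis[OF iA, of "h b"] by auto
      qed
    qed
    also have "\<dots> = mp.representation B (f d) d"
      using fin d D by (simp add: sum.delta)
    finally show ?thesis using comm dW by simp
  qed
  hence trA': "trace_on (h ` W) g = (\<Sum>d\<in>D. mp.representation B (f d) d)"
    using trA by simp
  have trK: "trace_on K f = (\<Sum>c\<in>C. mp.representation B (f c) c)"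
  proof -
    have "mp.representation C (f c) = mp.representation B (f c)" if "c \<in> C" for c
    proof -
      have "f c \<in> mp.span C" using K(3) C(1) that KC by blast
      thus ?thesis using mp.representation_extend[OF B(3) _ B(1)] by simp
    qed
    thus ?thesis
      using trace_on_basis[OF C K(2,1) f(1) K(3)] by simp
  qed
  have "trace_on W f = (\<Sum>b\<in>B. mp.representation B (f b) b)"
    using trace_on_basis[OF B(2-4) W(2,1) f] .
  also have "\<dots> = trace_on K f + trace_on (h ` W) g"
    unfolding trK trA' D(4) using D fin by (subst sum.union_disjoint) auto
  finally show ?thesis unfolding K_def .
qed

lemma trace_on_zero [simp]:
  fixes f :: "'v mpoly \<Rightarrow> 'v mpoly"
  shows "trace_on {0} f = 0"
proof -
  define B where "B = (SOME B::'v mpoly set. B \<subseteq> {0} \<and> mp.independent B \<and> {0} \<subseteq> mp.span B)"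
  have "B \<subseteq> {0} \<and> mp.independent B \<and> {0} \<subseteq> mp.span B"
    unfolding B_def by (rule someI[of _ "{}"]) (auto simp: mp.independent_empty)
  hence "B = {}" using mp.dependent_zero[of B] by auto
  thus ?thesis unfolding trace_on_def Let_def B_def[symmetric] by simp
qed

text \<open>An injective \<open>h\<close> has zero kernel on \<open>W\<close>, so the kernel term of
  \<open>trace_on_exact\<close> disappears.\<close>

lemma trace_on_conj:
  assumes "mp.subspace W" "finite_dim W" and "mlinear f" "f ` W \<subseteq> W" "mlinear g" "mlinear h"
    and comm: "\<And>w. w \<in> W \<Longrightarrow> h (f w) = g (h w)" and inj: "\<And>w. w \<in> W \<Longrightarrow> h w = 0 \<Longrightarrow> w = 0"
  shows "trace_on (h ` W) g = trace_on W f"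
proof -
  have "{w \<in> W. h w = 0} = {0}"
    using inj mp.subspace_0[OF assms(1)] mpp.linear_0[OF assms(6)] by auto
  thus ?thesis using trace_on_exact[OF assms(1-7)] by simp
qed

lemma trace_on_id:
  assumes "mp.subspace W" "finite_dim W"
  shows "trace_on W (\<lambda>w. w) = of_nat (mp.dim W)"
proof -
  obtain B where B: "B \<subseteq> W" "mp.independent B" "W \<subseteq> mp.span B" "card B = mp.dim W"
    using mp.basis_exists by blast
  have "trace_on W (\<lambda>w. w) = (\<Sum>b\<in>B. mp.representation B b b)"
    using trace_on_basis[OF B(1-3) assms(2,1) mp.linear_ident] by simp
  also have "\<dots> = (\<Sum>b\<in>B. 1)"
    using B(2) by (intro sum.cong refl) (simp add: mp.representation_basis)
  finally show ?thesis using B by simp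
qed

text \<open>Rank-nullity is additivity of the trace for the identity map; the traces are rational
  numbers, so the equation descends to natural numbers.\<close>

lemma dim_kernel_image:
  assumes "mp.subspace W" "finite_dim W" "mlinear h"
  shows "mp.dim W = mp.dim {w \<in> W. h w = 0} + mp.dim (h ` W)"
proof -
  have K: "mp.subspace {w \<in> W. h w = 0}" "finite_dim {w \<in> W. h w = 0}"
    using mp.subspace_inter[OF assms(1) mpp.linear_subspace_kernel[OF assms(3)]]
      finite_dim_subset[OF assms(2), of "{w \<in> W. h w = 0}"]
    by (simp_all add: Collect_conj_eq)
  have "(of_nat (mp.dim W) :: rat) = of_nat (mp.dim {w \<in> W. h w = 0}) + of_nat (mp.dim (h ` W))"
    unfolding trace_on_id[OF K, symmetric] trace_on_id[OF assms(1,2), symmetric]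
      trace_on_id[OF mpp.linear_subspace_image[OF assms(3,1)] finite_dim_image[OF assms(2,3)], symmetric]
    by (rule trace_on_exact[OF assms(1,2) mp.linear_ident _ mp.linear_ident assms(3)]) auto
  thus ?thesis by (simp flip: of_nat_add)
qed

lemma dim_mono:
  assumes "V \<subseteq> W" "finite_dim W"
  shows "mp.dim V \<le> mp.dim W"
proof -
  obtain B where B: "B \<subseteq> W" "mp.independent B" "W \<subseteq> mp.span B" "card B = mp.dim W"
    using mp.basis_exists by blast
  have "finite B" using finite_dim_independent assms(2) B(1,2) by blast
  thus ?thesis using mp.dim_le_card[of V B] B(3,4) assms(1) by (metis order_trans)
qed

lemma subspace_dim_equal:
  assumes "V \<subseteq> W" "mp.subspace V" "finite_dim W" "mp.dim W \<le> mp.dim V"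
  shows "V = W"
proof -
  obtain B where B: "B \<subseteq> V" "mp.independent B" "V \<subseteq> mp.span B" "card B = mp.dim V"
    using mp.basis_exists by blast
  obtain C where C: "B \<subseteq> C" "C \<subseteq> W" "mp.independent C" "W \<subseteq> mp.span C"
    using mp.maximal_independent_subset_extend[OF subset_trans[OF B(1) assms(1)] B(2)] by blast
  have "finite C" using C assms finite_dim_independent by blast
  moreover have "card C = mp.dim W" using C mp.basis_card_eq_dim by blast
  ultimately have "B = C" using assms B C by (simp add: card_seteq)
  then show ?thesis using C B assms mp.span_subspace by blast
qed

section \<open>Derivatives, permutations and bidegrees\<close>

lemma lookup_mscale [simp]: "Poly_Mapping.lookup (mscale c P) m = c * Poly_Mapping.lookup P m"
  unfolding mscale_def Const_def mult_map_scale_conv_mult[symmetric]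
  by (simp add: Poly_Mapping.map.rep_eq when_def)

lemma Var_power: "Var v ^ k = Poly_Mapping.single (Poly_Mapping.single v k) 1"
  by (induction k) (auto simp: Var_def mult_single simp flip: single_add single_one)

lemma prod_single:
  "(\<Prod>i\<in>I. Poly_Mapping.single (m i) (c i)) = Poly_Mapping.single (\<Sum>i\<in>I. m i) (\<Prod>i\<in>I. c i :: rat)"
  by (induction I rule: infinite_finite_induct) (auto simp: mult_single single_one[symmetric] simp del: single_one)

text \<open>Only the monomial obtained from \<open>m\<close> by one more factor \<open>v\<close>
  contributes: a monomial without \<open>v\<close> is left fixed by the truncated subtraction, but
  carries the factor 0.\<close>

lemma lookup_partial_deriv:
  "Poly_Mapping.lookup (partial_deriv v P) m
    = of_nat (Poly_Mapping.lookup m v + 1) * Poly_Mapping.lookup P (m + Poly_Mapping.single v 1)"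
proof -
  let ?e = "Poly_Mapping.single v (1::nat)"
  have "(of_nat (Poly_Mapping.lookup m' v) * Poly_Mapping.lookup P m' when m' - ?e = m)
      = (if m' = m + ?e then of_nat (Poly_Mapping.lookup m v + 1) * Poly_Mapping.lookup P m' else 0)" for m'
  proof (cases "Poly_Mapping.lookup m' v = 0")
    case True
    then show ?thesis by (auto simp: when_def lookup_add)
  next
    case False
    have "m' = (m' - ?e) + ?e"
      using False by (intro poly_mapping_eqI) (auto simp: lookup_add lookup_minus lookup_single when_def)
    hence "m' - ?e = m \<longleftrightarrow> m' = m + ?e" by (metis add_diff_cancel_right')
    then show ?thesis by (auto simp: when_def lookup_add)
  qed
  thus ?thesis
    unfolding partial_deriv_def lookup_sum lookup_single
    by (simp add: sum.delta in_keys_iff)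
qed

lemma mlinear_partial_deriv: "mlinear (partial_deriv v)"
  by (intro mlinearI poly_mapping_eqI) (simp_all add: lookup_partial_deriv lookup_add algebra_simps)

lemma partial_deriv_commute: "partial_deriv v (partial_deriv w P) = partial_deriv w (partial_deriv v P)"
  by (intro poly_mapping_eqI)
    (auto simp: lookup_partial_deriv lookup_add lookup_single when_def add_ac)

lemma mlinear_fold_partial_deriv: "mlinear (fold partial_deriv vs)"
proof (induction vs)
  case Nil
  then show ?case using mp.linear_id by (simp add: id_def)
next
  case (Cons v vs)
  then show ?case
    using Vector_Spaces.linear_compose[OF mlinear_partial_deriv Cons] by (simp add: comp_def)
qed

lemma mlinear_funpow:
  fixes f :: "'v mpoly \<Rightarrow> 'v mpoly"
  assumes "mlinear f"
  shows "mlinear (f ^^ k)"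
proof (induction k)
  case 0
  then show ?case using mp.linear_id by (simp add: id_def)
next
  case (Suc k)
  then show ?case
    using Vector_Spaces.linear_compose[OF Suc assms] by (simp add: comp_def)
qed

lemma partial_deriv_fold_commute:
  "partial_deriv v (fold partial_deriv vs P) = fold partial_deriv vs (partial_deriv v P)"
  by (induction vs arbitrary: P) (simp_all add: partial_deriv_commute)

lemma partial_deriv_funpow_fold_commute:
  "(partial_deriv v ^^ k) (fold partial_deriv vs P) = fold partial_deriv vs ((partial_deriv v ^^ k) P)"
  by (induction k) (simp_all add: partial_deriv_fold_commute)

lemma partial_deriv_funpow_commute:
  "(partial_deriv v ^^ k) ((partial_deriv w ^^ l) P) = (partial_deriv w ^^ l) ((partial_deriv v ^^ k) P)"
proof -
  have "partial_deriv v ((partial_deriv w ^^ l) P) = (partial_deriv w ^^ l) (partial_deriv v P)" for P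
    by (induction l) (simp_all add: partial_deriv_commute[of v w])
  thus ?thesis by (induction k) simp_all
qed

lemma lookup_partial_deriv_funpow:
  "Poly_Mapping.lookup ((partial_deriv v ^^ k) P) m
    = pochhammer (of_nat (Poly_Mapping.lookup m v + 1)) k
      * Poly_Mapping.lookup P (m + Poly_Mapping.single v k)"
proof (induction k arbitrary: m)
  case (Suc k)
  have "m + Poly_Mapping.single v 1 + Poly_Mapping.single v k = m + Poly_Mapping.single v (Suc k)"
    by (simp add: add.assoc flip: single_add)
  then show ?case
    using Suc[of "m + Poly_Mapping.single v 1"]
    by (simp add: lookup_partial_deriv pochhammer_rec lookup_add add_ac)
qed simp

text \<open>A list of variables serves both as a differential operator and as a monomial; this is
  the common exponent vector.\<close>

definition mon_of :: "'v list \<Rightarrow> 'v \<Rightarrow>\<^sub>0 nat" where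
  "mon_of vs = (\<Sum>v\<leftarrow>vs. Poly_Mapping.single v 1)"

text \<open>This is m!, the value of the differential operator with exponents m on the monomial with
  exponents m.\<close>

definition mfact :: "('v \<Rightarrow>\<^sub>0 nat) \<Rightarrow> rat" where
  "mfact m = (\<Prod>v\<in>Poly_Mapping.keys m. fact (Poly_Mapping.lookup m v))"

lemma mfact_superset:
  assumes "finite V" "Poly_Mapping.keys m \<subseteq> V"
  shows "mfact m = (\<Prod>v\<in>V. fact (Poly_Mapping.lookup m v))"
  unfolding mfact_def using assms by (intro prod.mono_neutral_left) (auto simp: in_keys_iff)

lemma mfact_add_single:
  "mfact (m + Poly_Mapping.single v 1) = of_nat (Poly_Mapping.lookup m v + 1) * mfact m"
proof -
  let ?m = "m + Poly_Mapping.single v 1" and ?V = "insert v (Poly_Mapping.keys m)"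
  have 1: "mfact ?m = (\<Prod>w\<in>?V. fact (Poly_Mapping.lookup ?m w))"
    by (rule mfact_superset) (use keys_add in fastforce)+
  have "(\<Prod>w\<in>?V - {v}. fact (Poly_Mapping.lookup ?m w) :: rat)
      = (\<Prod>w\<in>?V - {v}. fact (Poly_Mapping.lookup m w))"
    by (intro prod.cong) (auto simp: lookup_add lookup_single)
  hence "mfact ?m = fact (Poly_Mapping.lookup m v + 1) * (\<Prod>w\<in>?V - {v}. fact (Poly_Mapping.lookup m w))"
    unfolding 1 by (subst prod.remove[of _ v]) (simp_all add: lookup_add)
  also have "\<dots> = of_nat (Poly_Mapping.lookup m v + 1) * (\<Prod>w\<in>?V. fact (Poly_Mapping.lookup m w))"
    by (subst (2) prod.remove[of _ v]) simp_all
  also have "(\<Prod>w\<in>?V. fact (Poly_Mapping.lookup m w)) = mfact m"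
    by (rule mfact_superset[symmetric]) auto
  finally show ?thesis .
qed

text \<open>The constant term after differentiation is the differentiation pairing of the monomial
  of \<open>vs\<close> with \<open>P\<close>; each derivative contributes one factor of the
  factorials.\<close>

lemma lookup_fold_partial_deriv_0:
  "Poly_Mapping.lookup (fold partial_deriv vs P) 0 = mfact (mon_of vs) * Poly_Mapping.lookup P (mon_of vs)"
proof (induction vs arbitrary: P)
  case (Cons v vs)
  have "mon_of (v # vs) = mon_of vs + Poly_Mapping.single v 1"
    by (simp add: mon_of_def add.commute)
  then show ?case
    using Cons[of "partial_deriv v P"]
    by (simp add: lookup_partial_deriv mfact_add_single[unfolded One_nat_def] mult_ac)
qed (simp add: mon_of_def mfact_def)

section \<open>The diagonal action of permutations\<close>

definition vperm :: "(nat \<Rightarrow> nat) \<Rightarrow> xyvar \<Rightarrow> xyvar" where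
  "vperm \<sigma> v = (case v of X i \<Rightarrow> X (\<sigma> i) | Y i \<Rightarrow> Y (\<sigma> i))"

lemma vperm_simps [simp]: "vperm \<sigma> (X i) = X (\<sigma> i)" "vperm \<sigma> (Y i) = Y (\<sigma> i)"
  by (simp_all add: vperm_def)

lemma vperm_comp: "vperm (\<sigma> \<circ> \<tau>) = vperm \<sigma> \<circ> vperm \<tau>"
  by (auto simp: vperm_def fun_eq_iff split: xyvar.splits)

lemma vperm_ident: "vperm id = id"
  by (auto simp: vperm_def fun_eq_iff split: xyvar.splits)

lemma bij_vperm:
  assumes "bij \<sigma>"
  shows "bij (vperm \<sigma>)"
proof (rule bijI)
  show "inj (vperm \<sigma>)"
    using bij_is_inj[OF assms] by (auto simp: vperm_def inj_def split: xyvar.splits)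
  show "surj (vperm \<sigma>)"
    unfolding surj_def
  proof
    fix v
    obtain i where "(case v of X j \<Rightarrow> j | Y j \<Rightarrow> j) = \<sigma> i"
      using bij_is_surj[OF assms] by blast
    thus "\<exists>w. v = vperm \<sigma> w"
      by (cases v) (metis vperm_simps xyvar.case)+
  qed
qed

text \<open>Exponents are pulled back along the permutation of the variables, so this undoes the
  action of \<open>\<sigma>\<close> on monomials.\<close>

abbreviation mperm :: "(nat \<Rightarrow> nat) \<Rightarrow> (xyvar \<Rightarrow>\<^sub>0 nat) \<Rightarrow> xyvar \<Rightarrow>\<^sub>0 nat" where
  "mperm \<sigma> \<equiv> Poly_Mapping.map_key (vperm \<sigma>)"

lemma lookup_mperm:
  "bij \<sigma> \<Longrightarrow> Poly_Mapping.lookup (mperm \<sigma> m) v = Poly_Mapping.lookup m (vperm \<sigma> v)"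
  using bij_vperm[of \<sigma>] by (simp add: map_key.rep_eq bij_is_inj)

lemma mperm_add: "bij \<sigma> \<Longrightarrow> mperm \<sigma> (m + m') = mperm \<sigma> m + mperm \<sigma> m'"
  using bij_vperm[of \<sigma>] by (simp add: map_key_plus bij_is_inj)

lemma mperm_single: "bij \<sigma> \<Longrightarrow> mperm \<sigma> (Poly_Mapping.single (vperm \<sigma> v) k) = Poly_Mapping.single v k"
  using bij_vperm[of \<sigma>] by (simp add: map_key_single bij_is_inj)

lemma mperm_inject:
  assumes "bij \<sigma>"
  shows "mperm \<sigma> m = mperm \<sigma> m' \<longleftrightarrow> m = m'"
proof
  assume eq: "mperm \<sigma> m = mperm \<sigma> m'"
  show "m = m'"
  proof (rule poly_mapping_eqI)
    fix v
    obtain w where "v = vperm \<sigma> w" using bij_vperm[OF assms] by (metis bij_pointE)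
    thus "Poly_Mapping.lookup m v = Poly_Mapping.lookup m' v"
      using eq lookup_mperm[OF assms] by metis
  qed
qed simp

text \<open>\<open>act\<close> is the effect of \<open>\<sigma>\<close> on monomials and
  \<open>mperm \<sigma>\<close> inverts it, so \<open>mperm \<sigma> m\<close> is the only monomial
  that lands on \<open>m\<close>.\<close>

lemma lookup_diag_action:
  assumes "bij \<sigma>"
  shows "Poly_Mapping.lookup (diag_action \<sigma> P) m = Poly_Mapping.lookup P (mperm \<sigma> m)"
proof -
  define act where "act m' = (\<Sum>v\<in>Poly_Mapping.keys m'. Poly_Mapping.single (vperm \<sigma> v) (Poly_Mapping.lookup m' v))"
    for m' :: "xyvar \<Rightarrow>\<^sub>0 nat"
  have inj: "vperm \<sigma> v = vperm \<sigma> w \<longleftrightarrow> v = w" for v w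
    using bij_vperm[OF assms] by (simp add: bij_is_inj inj_eq)
  have act_eq: "mperm \<sigma> (act m') = m'" for m'
    by (rule poly_mapping_eqI)
      (simp add: lookup_mperm[OF assms] act_def lookup_sum lookup_single inj when_def sum.delta in_keys_iff)
  have act_iff: "act m' = m \<longleftrightarrow> m' = mperm \<sigma> m" for m'
    using mperm_inject[OF assms, of "act m'" m] act_eq by auto
  have *: "(case v of X i \<Rightarrow> Var (X (\<sigma> i)) | Y i \<Rightarrow> Var (Y (\<sigma> i))) = (Var (vperm \<sigma> v) :: xyvar mpoly)" for v
    by (simp split: xyvar.splits)
  have "diag_action \<sigma> P = (\<Sum>m'\<in>Poly_Mapping.keys P. Poly_Mapping.single (act m') (Poly_Mapping.lookup P m'))"
    unfolding diag_action_def substitute_def * Var_power prod_single Const_def act_def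
    by (simp add: mult_single)
  thus ?thesis
    by (simp add: lookup_sum lookup_single act_iff when_def sum.delta in_keys_iff)
qed

lemma mlinear_diag_action: "bij \<sigma> \<Longrightarrow> mlinear (diag_action \<sigma>)"
  by (intro mlinearI poly_mapping_eqI) (simp_all add: lookup_diag_action lookup_add)

lemma diag_action_comp:
  assumes "bij \<sigma>" "bij \<tau>"
  shows "diag_action \<sigma> (diag_action \<tau> P) = diag_action (\<sigma> \<circ> \<tau>) P"
proof (rule poly_mapping_eqI)
  fix m
  have "mperm \<tau> (mperm \<sigma> m) = mperm (\<sigma> \<circ> \<tau>) m"
    by (rule poly_mapping_eqI) (simp add: assms lookup_mperm bij_comp, simp add: vperm_comp)
  thus "Poly_Mapping.lookup (diag_action \<sigma> (diag_action \<tau> P)) m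
      = Poly_Mapping.lookup (diag_action (\<sigma> \<circ> \<tau>) P) m"
    by (simp add: assms lookup_diag_action bij_comp)
qed

lemma diag_action_id: "diag_action id P = P"
proof (rule poly_mapping_eqI)
  fix m
  have "mperm id m = m"
    by (rule poly_mapping_eqI) (simp add: lookup_mperm, simp add: vperm_ident)
  thus "Poly_Mapping.lookup (diag_action id P) m = Poly_Mapping.lookup P m"
    by (simp add: lookup_diag_action)
qed

lemma diag_action_partial_deriv:
  assumes "bij \<sigma>"
  shows "diag_action \<sigma> (partial_deriv v P) = partial_deriv (vperm \<sigma> v) (diag_action \<sigma> P)"
  by (rule poly_mapping_eqI)
    (simp add: assms lookup_diag_action lookup_partial_deriv lookup_mperm mperm_add
      mperm_single[unfolded One_nat_def])

lemma diag_action_fold_partial_deriv: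
  assumes "bij \<sigma>"
  shows "diag_action \<sigma> (fold partial_deriv vs P)
    = fold partial_deriv (map (vperm \<sigma>) vs) (diag_action \<sigma> P)"
  by (induction vs arbitrary: P) (simp_all add: diag_action_partial_deriv assms)

lemma diag_action_funpow:
  assumes "bij \<sigma>"
  shows "diag_action \<sigma> ((partial_deriv v ^^ k) P) = (partial_deriv (vperm \<sigma> v) ^^ k) (diag_action \<sigma> P)"
  by (induction k) (simp_all add: diag_action_partial_deriv assms)

section \<open>Bidegrees and bihomogeneous components\<close>

lemma xdegree_add: "xdegree (m + m') = xdegree m + xdegree m'"
  unfolding xdegree_def by (rule setsum_keys_plus_distrib) (auto split: xyvar.splits)

lemma ydegree_add: "ydegree (m + m') = ydegree m + ydegree m'"
  unfolding ydegree_def by (rule setsum_keys_plus_distrib) (auto split: xyvar.splits)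

lemma xdegree_single: "xdegree (Poly_Mapping.single v k) = (case v of X _ \<Rightarrow> k | Y _ \<Rightarrow> 0)"
  by (simp add: xdegree_def split: xyvar.splits)

lemma ydegree_single: "ydegree (Poly_Mapping.single v k) = (case v of X _ \<Rightarrow> 0 | Y _ \<Rightarrow> k)"
  by (simp add: ydegree_def split: xyvar.splits)

lemma degree_mperm:
  assumes "bij \<sigma>"
  shows "xdegree (mperm \<sigma> m) = xdegree m" "ydegree (mperm \<sigma> m) = ydegree m"
proof -
  have keys: "Poly_Mapping.keys (mperm \<sigma> m) = vperm \<sigma> -` Poly_Mapping.keys m"
    using bij_vperm[OF assms] by (simp add: keys_map_key bij_is_inj)
  have bij: "bij_betw (vperm \<sigma>) (vperm \<sigma> -` Poly_Mapping.keys m) (Poly_Mapping.keys m)"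
    using bij_vperm[OF assms] unfolding bij_betw_def
    by (metis bij_def inj_on_subset subset_UNIV surj_image_vimage_eq)
  show "xdegree (mperm \<sigma> m) = xdegree m"
    unfolding xdegree_def keys sum.reindex_bij_betw[OF bij, symmetric] lookup_mperm[OF assms]
    by (intro sum.cong) (auto simp: vperm_def split: xyvar.splits)
  show "ydegree (mperm \<sigma> m) = ydegree m"
    unfolding ydegree_def keys sum.reindex_bij_betw[OF bij, symmetric] lookup_mperm[OF assms]
    by (intro sum.cong) (auto simp: vperm_def split: xyvar.splits)
qed

text \<open>A linear projection: its fixed space consists of the bihomogeneous elements, and
  stability of a subspace under it can be tested on generators.\<close>

definition bicomp :: "nat \<Rightarrow> nat \<Rightarrow> xyvar mpoly \<Rightarrow> xyvar mpoly" where
  "bicomp h k = Poly_Mapping.mapp (\<lambda>m c. if xdegree m = h \<and> ydegree m = k then c else 0)"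

lemma lookup_bicomp:
  "Poly_Mapping.lookup (bicomp h k P) m
    = (if xdegree m = h \<and> ydegree m = k then Poly_Mapping.lookup P m else 0)"
  by (simp add: bicomp_def lookup_mapp when_def in_keys_iff)

lemma mlinear_bicomp: "mlinear (bicomp h k)"
  by (intro mlinearI poly_mapping_eqI) (simp_all add: lookup_bicomp lookup_add)

lemma bihomogeneous_iff:
  "bihomogeneous h k P \<longleftrightarrow> (\<forall>m. Poly_Mapping.lookup P m \<noteq> 0 \<longrightarrow> xdegree m = h \<and> ydegree m = k)"
  by (auto simp: bihomogeneous_def in_keys_iff)

lemma bihomogeneous_bicomp: "bihomogeneous h k (bicomp h k P)"
  by (auto simp: bihomogeneous_iff lookup_bicomp)

lemma bicomp_bihomogeneous:
  assumes "bihomogeneous h k P"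
  shows "bicomp h' k' P = (if h = h' \<and> k = k' then P else 0)"
  using assms by (intro poly_mapping_eqI) (auto simp: bihomogeneous_iff lookup_bicomp)

lemma bihomogeneous_diag_action:
  assumes "bij \<sigma>" "bihomogeneous h k P"
  shows "bihomogeneous h k (diag_action \<sigma> P)"
  unfolding bihomogeneous_iff
proof (intro allI impI)
  fix m assume "Poly_Mapping.lookup (diag_action \<sigma> P) m \<noteq> 0"
  hence "xdegree (mperm \<sigma> m) = h \<and> ydegree (mperm \<sigma> m) = k"
    using assms by (simp add: lookup_diag_action bihomogeneous_iff)
  thus "xdegree m = h \<and> ydegree m = k" by (simp add: degree_mperm assms(1))
qed

text \<open>The truncation at degree 0 is harmless, because the derivative is then zero and zero is
  bihomogeneous of every bidegree.\<close>

lemma bihomogeneous_partial_deriv: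
  assumes "bihomogeneous h k P"
  shows "bihomogeneous (case v of X _ \<Rightarrow> h - 1 | Y _ \<Rightarrow> h) (case v of X _ \<Rightarrow> k | Y _ \<Rightarrow> k - 1) (partial_deriv v P)"
  using assms
  by (auto simp: bihomogeneous_iff lookup_partial_deriv xdegree_add ydegree_add xdegree_single ydegree_single
      split: xyvar.splits)

lemma subspace_bihomogeneous: "mp.subspace {P. bihomogeneous h k P}"
proof -
  have "bihomogeneous h k P \<longleftrightarrow> bicomp h k P = P" for P
    using bicomp_bihomogeneous bihomogeneous_bicomp by metis
  thus ?thesis
    using mpp.linear_subspace_kernel[OF mpp.linear_compose_sub[OF mlinear_bicomp[of h k] mp.linear_ident]]
    by simp
qed

lemma subspace_bihom_part: "mp.subspace W \<Longrightarrow> mp.subspace (bihom_part h k W)"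
  using mp.subspace_inter[OF _ subspace_bihomogeneous] by (simp add: bihom_part_def Collect_conj_eq)

section \<open>Determinants of biexponents\<close>

definition varset :: "nat \<Rightarrow> xyvar set" where
  "varset N = X ` {..<N} \<union> Y ` {..<N}"

lemma finite_varset [simp]: "finite (varset N)"
  by (simp add: varset_def)

lemma mem_varset [simp]: "X a \<in> varset N \<longleftrightarrow> a < N" "Y a \<in> varset N \<longleftrightarrow> a < N"
  by (auto simp: varset_def)

lemma sum_varset: "(\<Sum>v\<in>varset N. g v) = (\<Sum>a<N. g (X a) + g (Y a) :: 'a :: comm_monoid_add)"
  unfolding varset_def
  by (subst sum.union_disjoint) (auto simp: sum.reindex inj_on_def sum.distrib)

lemma prod_varset: "(\<Prod>v\<in>varset N. g v) = (\<Prod>a<N. g (X a) * g (Y a) :: 'a :: comm_monoid_mult)"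
  unfolding varset_def
  by (subst prod.union_disjoint) (auto simp: prod.reindex inj_on_def prod.distrib)

definition detmon :: "(nat \<times> nat) list \<Rightarrow> (nat \<Rightarrow> nat) \<Rightarrow> xyvar \<Rightarrow>\<^sub>0 nat" where
  "detmon E \<pi> = (\<Sum>a<length E. Poly_Mapping.single (X a) (fst (E ! \<pi> a)) + Poly_Mapping.single (Y a) (snd (E ! \<pi> a)))"

text \<open>The Leibniz expansion of the determinant, for an arbitrary list of cells, so that the
  rectangle and the rectangle without its corner are treated alike.\<close>

definition bidet :: "(nat \<times> nat) list \<Rightarrow> xyvar mpoly" where
  "bidet E = (\<Sum>\<pi> | \<pi> permutes {..<length E}. Poly_Mapping.single (detmon E \<pi>) (of_int (sign \<pi>)))"

lemma lookup_detmon [simp]: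
  "Poly_Mapping.lookup (detmon E \<pi>) (X a) = (if a < length E then fst (E ! \<pi> a) else 0)"
  "Poly_Mapping.lookup (detmon E \<pi>) (Y a) = (if a < length E then snd (E ! \<pi> a) else 0)"
  by (auto simp: detmon_def lookup_sum lookup_add lookup_single when_def sum.delta)

lemma eq_detmon_iff:
  "m = detmon E \<pi> \<longleftrightarrow> Poly_Mapping.keys m \<subseteq> varset (length E) \<and>
    (\<forall>a<length E. (Poly_Mapping.lookup m (X a), Poly_Mapping.lookup m (Y a)) = E ! \<pi> a)" (is "?l \<longleftrightarrow> ?r")
proof
  assume ?l
  have "v \<in> varset (length E)" if "Poly_Mapping.lookup (detmon E \<pi>) v \<noteq> 0" for v
    using that by (cases v) (auto split: if_splits)
  thus ?r using \<open>?l\<close> by (auto simp: in_keys_iff)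
next
  assume r: ?r
  show ?l
  proof (rule poly_mapping_eqI)
    fix v
    show "Poly_Mapping.lookup m v = Poly_Mapping.lookup (detmon E \<pi>) v"
    proof (cases "v \<in> varset (length E)")
      case True
      then show ?thesis using r by (cases v) (auto simp: prod_eq_iff)
    next
      case False
      hence "Poly_Mapping.lookup m v = 0" using r by (auto simp: in_keys_iff)
      then show ?thesis using False by (cases v) auto
    qed
  qed
qed

lemma lookup_bidet:
  "Poly_Mapping.lookup (bidet E) m
    = (\<Sum>\<pi> | \<pi> permutes {..<length E}. if m = detmon E \<pi> then of_int (sign \<pi>) else 0)"
  by (auto simp: bidet_def lookup_sum lookup_single when_def intro!: sum.cong)

lemma lookup_bidet_nonzero:
  assumes "Poly_Mapping.lookup (bidet E) m \<noteq> 0"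
  obtains \<pi> where "\<pi> permutes {..<length E}" "m = detmon E \<pi>"
proof -
  have "\<exists>\<pi>. \<pi> permutes {..<length E} \<and> m = detmon E \<pi>"
    using assms unfolding lookup_bidet by (auto elim!: sum.not_neutral_contains_not_neutral split: if_splits)
  thus ?thesis using that by blast
qed

lemma sum_nth_permutes:
  assumes "\<pi> permutes {..<N}"
  shows "(\<Sum>a<N. g (E ! \<pi> a)) = (\<Sum>a<N. g (E ! a))"
  using sum.permute[OF assms, of "\<lambda>a. g (E ! a)"] by (simp add: comp_def)

lemma length_biexponents: "length (biexponents \<mu>) = sum_list \<mu>"
proof -
  have "map ((!) \<mu>) [0..<length \<mu>] = \<mu>" by (rule map_nth)
  thus ?thesis
    by (simp add: biexponents_def length_concat comp_def)
qed

lemma set_biexponents: "set (biexponents \<mu>) = {(p, q). p < length \<mu> \<and> q < \<mu> ! p}"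
  by (auto simp: biexponents_def)

lemma distinct_biexponents: "distinct (biexponents \<mu>)"
proof (rule card_distinct)
  have "set (biexponents \<mu>) = (SIGMA p:{..<length \<mu>}. {..<\<mu> ! p})"
    by (auto simp: set_biexponents)
  thus "card (set (biexponents \<mu>)) = length (biexponents \<mu>)"
    by (simp add: length_biexponents sum_list_sum_nth atLeast0LessThan)
qed

lemma lattice_det_bidet: "lattice_det \<mu> = bidet (biexponents \<mu>)"
proof -
  define E where "E = biexponents \<mu>"
  have N: "sum_list \<mu> = length E" by (simp add: E_def length_biexponents)
  have "(\<Prod>i<length E. Var (X i) ^ fst (E ! \<pi> i) * Var (Y i) ^ snd (E ! \<pi> i))
      = Poly_Mapping.single (detmon E \<pi>) (1::rat)" for \<pi>
    by (simp add: Var_power mult_single prod_single detmon_def)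
  moreover have "(of_int k :: xyvar mpoly) * Poly_Mapping.single m 1 = Poly_Mapping.single m (of_int k)" for k m
    by (simp add: mult_single flip: single_of_int)
  ultimately show ?thesis
    unfolding lattice_det_def det_def bidet_def E_def[symmetric] N
    by (auto simp: atLeast0LessThan permutes_in_image intro!: sum.cong)
qed

section \<open>Words of variables as monomials\<close>

lemma mon_of_Nil [simp]: "mon_of [] = 0"
  and mon_of_Cons [simp]: "mon_of (v # vs) = Poly_Mapping.single v 1 + mon_of vs"
  and mon_of_append [simp]: "mon_of (us @ vs) = mon_of us + mon_of vs"
  by (simp_all add: mon_of_def)

lemma lookup_mon_of: "Poly_Mapping.lookup (mon_of vs) v = count_list vs v"
  by (induction vs) (auto simp: lookup_add lookup_single when_def)

lemma keys_mon_of: "Poly_Mapping.keys (mon_of vs) = set vs"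
  by (auto simp: in_keys_iff lookup_mon_of count_list_0_iff)

lemma mon_of_surj: "\<exists>vs. mon_of vs = m"
proof -
  have "\<exists>vs. mon_of vs = (\<Sum>v\<in>A. Poly_Mapping.single v (f v))" if "finite A" for A and f :: "'a \<Rightarrow> nat"
    using that
  proof (induction A)
    case (insert v A)
    then obtain vs where "mon_of vs = (\<Sum>v\<in>A. Poly_Mapping.single v (f v))" by blast
    moreover have "mon_of (replicate k v) = Poly_Mapping.single v k" for k
      by (induction k) (simp_all flip: single_add)
    ultimately have "mon_of (replicate (f v) v @ vs) = (\<Sum>v\<in>insert v A. Poly_Mapping.single v (f v))"
      using insert by simp
    thus ?case by blast
  qed (auto intro: exI[of _ "[]"])
  moreover have "m = (\<Sum>v\<in>Poly_Mapping.keys m. Poly_Mapping.single v (Poly_Mapping.lookup m v))"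
    by (rule poly_mapping_eqI) (simp add: lookup_sum lookup_single when_def sum.delta in_keys_iff)
  ultimately show ?thesis by (metis finite_keys)
qed

lemma length_eq_sum_mon_of:
  assumes "set vs \<subseteq> V" "finite V"
  shows "length vs = (\<Sum>v\<in>V. Poly_Mapping.lookup (mon_of vs) v)"
  using assms by (simp add: lookup_mon_of sum_count_set)

lemma prod_list_eq_prod_mon_of:
  fixes f :: "'v \<Rightarrow> 'a :: comm_monoid_mult"
  assumes "set vs \<subseteq> V" "finite V"
  shows "(\<Prod>v\<leftarrow>vs. f v) = (\<Prod>v\<in>V. f v ^ Poly_Mapping.lookup (mon_of vs) v)"
  using assms(1)
proof (induction vs)
  case (Cons u vs)
  have "(\<Prod>v\<in>V. f v ^ Poly_Mapping.lookup (mon_of (u # vs)) v)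
    = (\<Prod>v\<in>V. (if v = u then f v else 1) * f v ^ Poly_Mapping.lookup (mon_of vs) v)"
    by (intro prod.cong) (auto simp: lookup_add lookup_single)
  then show ?case using Cons assms(2) by (simp add: prod.distrib prod.delta)
qed simp

text \<open>Change from powers to the binomial basis. The coefficient is 0 for i > h and h! for i =
  h; this triangularity later isolates the part of lowest degree.\<close>

lemma power_eq_sum_Stirling:
  "(x :: nat) ^ h = (\<Sum>i\<le>h. Stirling h i * fact i * (x choose i))"
proof (induction h)
  case (Suc h)
  \<comment> \<open>This identity turns multiplication by x into the recurrence of the Stirling
    numbers.\<close>
  have step: "x * (x choose i) = Suc i * (x choose Suc i) + i * (x choose i)" for i
  proof (cases "i \<le> x")
    case True
    hence "x * (x choose i) = (x - i) * (x choose i) + i * (x choose i)"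
      by (simp flip: add_mult_distrib)
    also have "(x - i) * (x choose i) = Suc i * (x choose Suc i)"
      by (simp only: binomial_absorb_comp binomial_absorption)
    finally show ?thesis .
  qed (simp add: binomial_eq_0)
  define g where "g i = i * Stirling h i * fact i * (x choose i)" for i
  \<comment> \<open>The shift is possible because \<open>g\<close> vanishes at 0, by its factor i,
    and at h + 1, by the Stirling number.\<close>
  have g: "(\<Sum>i\<le>h. g i) = (\<Sum>i\<le>h. g (Suc i))"
    using sum.atMost_Suc_shift[of g h] sum.atMost_Suc[of g h] by (simp add: g_def)
  have "x ^ Suc h = (\<Sum>i\<le>h. Stirling h i * fact i * (x * (x choose i)))"
    by (simp add: Suc sum_distrib_left mult_ac)
  also have "\<dots> = (\<Sum>i\<le>h. Stirling h i * fact (Suc i) * (x choose Suc i)) + (\<Sum>i\<le>h. g i)"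
    unfolding step by (simp add: g_def algebra_simps sum.distrib)
  also have "\<dots> = (\<Sum>i\<le>h. Stirling (Suc h) (Suc i) * fact (Suc i) * (x choose Suc i))"
    unfolding g by (simp add: g_def algebra_simps flip: sum.distrib)
  also have "\<dots> = (\<Sum>i\<le>Suc h. Stirling (Suc h) i * fact i * (x choose i))"
    by (subst sum.atMost_Suc_shift) simp
  finally show ?case .
qed simp

section \<open>The upper bound from orbit points\<close>

text \<open>Evaluation of a variable at the point whose \<open>a\<close>-th coordinate pair is the
  cell \<open>E ! \<sigma> a\<close>; these points form the orbit under the symmetric group.\<close>

definition orbit_val :: "(nat \<times> nat) list \<Rightarrow> (nat \<Rightarrow> nat) \<Rightarrow> xyvar \<Rightarrow> rat" where
  "orbit_val E \<sigma> v = (case v of X a \<Rightarrow> of_nat (fst (E ! \<sigma> a)) | Y a \<Rightarrow> of_nat (snd (E ! \<sigma> a)))"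

definition down_closed :: "(nat \<times> nat) set \<Rightarrow> bool" where
  "down_closed S \<longleftrightarrow> (\<forall>p q i j. (p, q) \<in> S \<longrightarrow> i \<le> p \<longrightarrow> j \<le> q \<longrightarrow> (i, j) \<in> S)"

text \<open>The total degree of \<open>bidet E\<close>, in both sets of variables together.\<close>

definition bidegree :: "(nat \<times> nat) list \<Rightarrow> nat" where
  "bidegree E = (\<Sum>a<length E. fst (E ! a) + snd (E ! a))"

lemma sum_detmon:
  assumes "\<pi> permutes {..<length E}"
  shows "(\<Sum>v\<in>varset (length E). Poly_Mapping.lookup (detmon E \<pi>) v) = bidegree E"
  using sum_nth_permutes[OF assms, of "\<lambda>c. fst c + snd c" E]
  by (simp add: sum_varset bidegree_def)

text \<open>In the product of two binomial expansions, a cell outside \<open>E\<close> is not below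
  \<open>(p, q)\<close> by down-closedness, so one of its binomials is 0. Cells of \<open>E\<close>
  not below \<open>(h, k)\<close> may be added, as their Stirling numbers vanish.\<close>

lemma bipower_expand:
  assumes "distinct E" "down_closed (set E)" "(p, q) \<in> set E"
  shows "p ^ h * q ^ k = (\<Sum>l<length E.
    Stirling h (fst (E ! l)) * fact (fst (E ! l)) * (Stirling k (snd (E ! l)) * fact (snd (E ! l)))
    * ((p choose fst (E ! l)) * (q choose snd (E ! l))))"
proof -
  define f where "f = (\<lambda>(i, j). Stirling h i * fact i * (Stirling k j * fact j) * ((p choose i) * (q choose j)))"
  have "p ^ h * q ^ k = (\<Sum>i\<le>h. \<Sum>j\<le>k. f (i, j))"
    unfolding power_eq_sum_Stirling[of p h] power_eq_sum_Stirling[of q k] sum_product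
    by (simp add: f_def mult_ac)
  also have "\<dots> = (\<Sum>c\<in>{..h} \<times> {..k}. f c)"
    by (simp add: sum.cartesian_product)
  also have "\<dots> = (\<Sum>c\<in>({..h} \<times> {..k}) \<inter> set E. f c)"
  proof (rule sum.mono_neutral_right)
    show "\<forall>c\<in>{..h} \<times> {..k} - {..h} \<times> {..k} \<inter> set E. f c = 0"
    proof (rule ballI)
      fix c assume c: "c \<in> {..h} \<times> {..k} - {..h} \<times> {..k} \<inter> set E"
      obtain i j where ij: "c = (i, j)" by (cases c)
      hence "(i, j) \<notin> set E" using c by auto
      hence "p < i \<or> q < j" using assms(2,3) unfolding down_closed_def by (meson not_le)
      thus "f c = 0" unfolding ij f_def by (auto simp: binomial_eq_0)
    qed
  qed auto
  also have "\<dots> = (\<Sum>c\<in>set E. f c)"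
    by (rule sum.mono_neutral_left) (auto simp: f_def not_le intro: leI)
  also have "\<dots> = (\<Sum>l<length E. f (E ! l))"
    using sum.reindex_bij_betw[OF bij_betw_nth[OF assms(1) refl refl], of f] by simp
  finally show ?thesis by (simp add: f_def case_prod_unfold)
qed

text \<open>A permutation does not change the sum of either coordinate over all cells, so the
  inequalities are equalities, and distinct cells determine their positions.\<close>

lemma permutes_eq_id_if_nth_le:
  fixes E :: "(nat \<times> nat) list"
  assumes "distinct E" and \<pi>: "\<pi> permutes {..<length E}"
    and le: "\<And>l. l < length E \<Longrightarrow> fst (E ! l) \<le> fst (E ! \<pi> l) \<and> snd (E ! l) \<le> snd (E ! \<pi> l)"
  shows "\<pi> = id"
proof
  fix l
  show "\<pi> l = id l"
  proof (cases "l < length E")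
    case True
    have "fst (E ! l) = fst (E ! \<pi> l)"
      by (rule sum_mono_inv[OF sum_nth_permutes[OF \<pi>, of fst E, symmetric]])
        (use le True in auto)
    moreover have "snd (E ! l) = snd (E ! \<pi> l)"
      by (rule sum_mono_inv[OF sum_nth_permutes[OF \<pi>, of snd E, symmetric]])
        (use le True in auto)
    ultimately have "E ! l = E ! \<pi> l" by (simp add: prod_eq_iff)
    thus ?thesis
      using nth_eq_iff_index_eq[OF assms(1) True, of "\<pi> l"] permutes_in_image[OF \<pi>, of l] True by simp
  next
    case False
    thus ?thesis using permutes_not_in[OF \<pi>] by auto
  qed
qed

text \<open>The alternating sum of a polynomial over the orbit of the point with coordinates
  \<open>E ! a\<close> agrees, up to the degree of \<^term>\<open>bidet E\<close>, with the pairing of the polynomial with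
  \<^term>\<open>bidet E\<close> by differentiation. The determinant of powers factors through the
  determinant of binomial coefficients, which is unitriangular with respect to containment of cells.\<close>

lemma alternating_orbit_sum:
  assumes E: "distinct E" "down_closed (set E)"
    and vs: "set vs \<subseteq> varset (length E)" "length vs \<le> bidegree E"
  shows "(\<Sum>\<sigma> | \<sigma> permutes {..<length E}. of_int (sign \<sigma>) * (\<Prod>v\<leftarrow>vs. orbit_val E \<sigma> v))
    = mfact (mon_of vs) * Poly_Mapping.lookup (bidet E) (mon_of vs)"
proof -
  define N where "N = length E"
  define h where "h a = Poly_Mapping.lookup (mon_of vs) (X a)" for a
  define k where "k a = Poly_Mapping.lookup (mon_of vs) (Y a)" for a
  \<comment> \<open>Coefficients of powers in the binomial basis: 0 for i > n, and n! for i =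
    n.\<close>
  define c :: "nat \<Rightarrow> nat \<Rightarrow> nat" where "c n i = Stirling n i * fact i" for n i
  define R :: "rat mat" where "R = mat N N (\<lambda>(a, b). of_nat (fst (E ! b) ^ h a * snd (E ! b) ^ k a))"
  define C :: "rat mat" where "C = mat N N (\<lambda>(a, l). of_nat (c (h a) (fst (E ! l)) * c (k a) (snd (E ! l))))"
  define F :: "rat mat" where "F = mat N N (\<lambda>(l, b). of_nat ((fst (E ! b) choose fst (E ! l)) * (snd (E ! b) choose snd (E ! l))))"
  have perm_less: "\<pi> a < N" if "\<pi> permutes {..<N}" "a < N" for \<pi> a
    using permutes_in_image[OF that(1), of a] that(2) by simp
  \<comment> \<open>The powers evaluated at cells factor through binomials indexed by the same
    cells, since the expansion runs over \<open>E\<close> only; hence \<open>C\<close> and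
    \<open>F\<close> are square.\<close>
  have R: "R = C * F"
  proof (rule eq_matI)
    fix a b assume ab: "a < dim_row (C * F)" "b < dim_col (C * F)"
    hence ab: "a < N" "b < N" by (auto simp: C_def F_def)
    have "(fst (E ! b), snd (E ! b)) \<in> set E" using ab by (simp add: N_def)
    from bipower_expand[OF E this]
    have "fst (E ! b) ^ h a * snd (E ! b) ^ k a = (\<Sum>l<N. (c (h a) (fst (E ! l)) * c (k a) (snd (E ! l))) *
      ((fst (E ! b) choose fst (E ! l)) * (snd (E ! b) choose snd (E ! l))))"
      by (simp add: N_def c_def)
    thus "R $$ (a, b) = (C * F) $$ (a, b)"
      using ab by (simp add: R_def C_def F_def scalar_prod_def atLeast0LessThan flip: of_nat_mult of_nat_sum)
  qed (auto simp: R_def C_def F_def)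
  \<comment> \<open>A permutation contributes only if every cell is contained in its image, which
    leaves the identity, with all entries 1.\<close>
  have detF: "det F = 1"
  proof -
    have "det F = (\<Sum>\<pi> | \<pi> permutes {..<N}. of_int (sign \<pi>) * (\<Prod>l<N. F $$ (l, \<pi> l)))"
      by (simp add: det_def F_def atLeast0LessThan)
    also have "\<dots> = (\<Sum>\<pi> | \<pi> permutes {..<N}. if \<pi> = id then 1 else 0)"
    proof (intro sum.cong refl, clarify)
      fix \<pi> assume \<pi>: "\<pi> permutes {..<N}"
      show "of_int (sign \<pi>) * (\<Prod>l<N. F $$ (l, \<pi> l)) = (if \<pi> = id then 1 else 0)"
      proof (cases "\<pi> = id")
        case True
        then show ?thesis by (simp add: F_def sign_id)
      next
        case False
        then obtain l where "l < N" "\<not> (fst (E ! l) \<le> fst (E ! \<pi> l) \<and> snd (E ! l) \<le> snd (E ! \<pi> l))"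
          using permutes_eq_id_if_nth_le[OF E(1) \<pi>[unfolded N_def]] by (auto simp: N_def)
        moreover have "\<pi> l < N" using \<pi> \<open>l < N\<close> by (rule perm_less)
        ultimately have "F $$ (l, \<pi> l) = 0" by (auto simp: F_def binomial_eq_0 not_le)
        then show ?thesis using False \<open>l < N\<close> by auto
      qed
    qed
    also have "\<dots> = 1" using permutes_id by (subst sum.delta) (auto simp: finite_permutations)
    finally show ?thesis .
  qed
  have len: "length vs = (\<Sum>a<N. h a + k a)"
    using length_eq_sum_mon_of[OF vs(1)] by (simp add: sum_varset h_def k_def N_def)
  have mf: "mfact (mon_of vs) = (\<Prod>a<N. fact (h a) * fact (k a))"
    using mfact_superset[of "varset N" "mon_of vs"] vs(1)
    by (simp add: keys_mon_of N_def prod_varset h_def k_def)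
  have "det C = (\<Sum>\<pi> | \<pi> permutes {..<N}. of_int (sign \<pi>) * (\<Prod>a<N. C $$ (a, \<pi> a)))"
    by (simp add: det_def C_def atLeast0LessThan)
  also have "\<dots> = (\<Sum>\<pi> | \<pi> permutes {..<N}. if mon_of vs = detmon E \<pi> then of_int (sign \<pi>) * mfact (mon_of vs) else 0)"
  proof (intro sum.cong refl, clarify)
    fix \<pi> assume \<pi>: "\<pi> permutes {..<N}"
    have C: "C $$ (a, \<pi> a) = of_nat (c (h a) (fst (E ! \<pi> a)) * c (k a) (snd (E ! \<pi> a)))" if "a < N" for a
      using that perm_less[OF \<pi> that] by (simp add: C_def)
    have iff: "mon_of vs = detmon E \<pi> \<longleftrightarrow> (\<forall>a<N. h a = fst (E ! \<pi> a) \<and> k a = snd (E ! \<pi> a))"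
      unfolding eq_detmon_iff using vs(1) by (auto simp: keys_mon_of h_def k_def N_def prod_eq_iff)
    show "of_int (sign \<pi>) * (\<Prod>a<N. C $$ (a, \<pi> a))
      = (if mon_of vs = detmon E \<pi> then of_int (sign \<pi>) * mfact (mon_of vs) else 0)"
    proof (cases "mon_of vs = detmon E \<pi>")
      case True
      hence "(\<Prod>a<N. C $$ (a, \<pi> a)) = mfact (mon_of vs)"
        unfolding mf iff by (intro prod.cong refl) (simp add: C c_def)
      thus ?thesis using True by simp
    next
      case False
      \<comment> \<open>If no entry vanished, every cell \<open>E ! \<pi> a\<close> would lie below
        \<open>(h a, k a)\<close>. The degree bound on \<open>vs\<close> then forces equality
        everywhere, so that \<open>vs\<close> would be the monomial of \<open>\<pi>\<close>.\<close>
      have "\<exists>a<N. \<not> (fst (E ! \<pi> a) \<le> h a \<and> snd (E ! \<pi> a) \<le> k a)"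
      proof (rule ccontr)
        assume "\<not> ?thesis"
        hence le: "fst (E ! \<pi> a) \<le> h a" "snd (E ! \<pi> a) \<le> k a" if "a < N" for a using that by auto
        have "(\<Sum>a<N. fst (E ! \<pi> a) + snd (E ! \<pi> a)) = bidegree E"
          using sum_nth_permutes[OF \<pi>, of "\<lambda>c. fst c + snd c" E] by (simp add: bidegree_def N_def)
        moreover have "(\<Sum>a<N. fst (E ! \<pi> a) + snd (E ! \<pi> a)) \<le> (\<Sum>a<N. h a + k a)"
          using le by (intro sum_mono add_mono) auto
        ultimately have eq: "(\<Sum>a<N. fst (E ! \<pi> a) + snd (E ! \<pi> a)) = (\<Sum>a<N. h a + k a)"
          using vs(2) len by simp
        have "fst (E ! \<pi> a) + snd (E ! \<pi> a) = h a + k a" if "a < N" for a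
          by (rule sum_mono_inv[OF eq]) (use le that in \<open>auto intro: add_mono\<close>)
        hence "h a = fst (E ! \<pi> a) \<and> k a = snd (E ! \<pi> a)" if "a < N" for a
          using le[OF that] that by (metis add_le_cancel_left add_le_cancel_right antisym order_refl)
        thus False using False iff by blast
      qed
      then obtain a where a: "a < N" "\<not> (fst (E ! \<pi> a) \<le> h a \<and> snd (E ! \<pi> a) \<le> k a)" by blast
      hence "C $$ (a, \<pi> a) = 0" by (auto simp: C c_def not_le)
      thus ?thesis using False a(1) by auto
    qed
  qed
  also have "\<dots> = mfact (mon_of vs) * Poly_Mapping.lookup (bidet E) (mon_of vs)"
    unfolding lookup_bidet sum_distrib_left N_def by (intro sum.cong) auto
  finally have detC: "det C = mfact (mon_of vs) * Poly_Mapping.lookup (bidet E) (mon_of vs)" .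
  \<comment> \<open>The value of the monomial at an orbit point is a product of entries of
    \<open>R\<close>, so the alternating sum is the Leibniz expansion of its determinant.\<close>
  have "(\<Sum>\<sigma> | \<sigma> permutes {..<N}. of_int (sign \<sigma>) * (\<Prod>v\<leftarrow>vs. orbit_val E \<sigma> v)) = det R"
  proof -
    have "(\<Prod>v\<leftarrow>vs. orbit_val E \<sigma> v) = (\<Prod>a<N. R $$ (a, \<sigma> a))" if "\<sigma> permutes {..<N}" for \<sigma>
    proof -
      have "R $$ (a, \<sigma> a) = of_nat (fst (E ! \<sigma> a)) ^ h a * of_nat (snd (E ! \<sigma> a)) ^ k a" if "a < N" for a
        using that perm_less[OF \<open>\<sigma> permutes {..<N}\<close> that] by (simp add: R_def)
      thus ?thesis
        unfolding prod_list_eq_prod_mon_of[OF vs(1) finite_varset] prod_varset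
        by (simp add: orbit_val_def N_def h_def k_def)
    qed
    thus ?thesis by (simp add: det_def R_def atLeast0LessThan)
  qed
  also have "det R = det C * det F"
    unfolding R by (rule det_mult) (auto simp: C_def F_def)
  finally show ?thesis using detC detF by (simp add: N_def)
qed

definition biderivs :: "(nat \<times> nat) list \<Rightarrow> xyvar mpoly set" where
  "biderivs E = {fold partial_deriv vs (bidet E) |vs. set vs \<subseteq> varset (length E)}"

definition bimodule :: "(nat \<times> nat) list \<Rightarrow> xyvar mpoly set" where
  "bimodule E = mp.span (biderivs E)"

lemma deriv_module_bimodule: "deriv_module \<mu> = bimodule (biexponents \<mu>)"
  by (simp add: deriv_module_def bimodule_def biderivs_def lattice_det_bidet length_biexponents varset_def)

lemma lookup_fold_partial_deriv_nonzero:
  "Poly_Mapping.lookup (fold partial_deriv vs P) m \<noteq> 0 \<Longrightarrow> Poly_Mapping.lookup P (m + mon_of vs) \<noteq> 0"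
proof (induction vs arbitrary: P)
  case (Cons v vs)
  hence "Poly_Mapping.lookup (partial_deriv v P) (m + mon_of vs) \<noteq> 0" by simp
  thus ?case by (simp add: lookup_partial_deriv add_ac)
qed simp

text \<open>Each basis element comes from a word of variables; sending it to the values of that word
  on the orbit is injective. To refute a kernel element, its relation is multiplied by a monomial
  complementary to its longest words and summed over the orbit with signs.\<close>

lemma finite_dim_bimodule:
  assumes E: "distinct E" "down_closed (set E)"
  shows "finite_dim (bimodule E)" "mp.dim (bimodule E) \<le> fact (length E)"
proof -
  define N where "N = length E"
  define P where "P = {\<sigma>. \<sigma> permutes {..<N}}"
  have finP: "finite P" by (simp add: P_def finite_permutations)
  \<comment> \<open>Functions on the orbit are modelled as linear combinations of variables indexed
    by the permutations.\<close>
  define \<Phi> :: "xyvar list \<Rightarrow> (nat \<Rightarrow> nat) mpoly" where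
    "\<Phi> vs = (\<Sum>\<sigma>\<in>P. mscale (\<Prod>v\<leftarrow>vs. orbit_val E \<sigma> v) (Var \<sigma>))" for vs
  have lookup_\<Phi>: "Poly_Mapping.lookup (\<Phi> vs) (Poly_Mapping.single \<sigma> 1) = (\<Prod>v\<leftarrow>vs. orbit_val E \<sigma> v)"
    if "\<sigma> \<in> P" for vs \<sigma>
  proof -
    have "Poly_Mapping.lookup (Var \<tau> :: (nat \<Rightarrow> nat) mpoly) (Poly_Mapping.single \<sigma> (Suc 0)) = (if \<tau> = \<sigma> then 1 else 0)" for \<tau>
      by (auto simp: Var_def lookup_single when_def dest!: arg_cong[of _ _ Poly_Mapping.keys])
    hence *: "x * Poly_Mapping.lookup (Var \<tau> :: (nat \<Rightarrow> nat) mpoly) (Poly_Mapping.single \<sigma> (Suc 0))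
      = (if \<tau> = \<sigma> then x else 0)" for \<tau> x
      by simp
    show ?thesis using that finP by (simp add: \<Phi>_def lookup_sum * sum.delta)
  qed
  \<comment> \<open>The basis is taken among the derivatives themselves, so that every element has a
    word. Its finiteness only follows at the end, from injectivity.\<close>
  obtain B where B: "B \<subseteq> biderivs E" "mp.independent B" "biderivs E \<subseteq> mp.span B"
    using mp.maximal_independent_subset by blast
  have spanB: "mp.span B = bimodule E"
    unfolding bimodule_def using B mp.span_mono mp.span_minimal[OF B(3)] by blast
  have "\<forall>b\<in>B. \<exists>vs. set vs \<subseteq> varset N \<and> b = fold partial_deriv vs (bidet E)"
    using B(1) by (auto simp: biderivs_def N_def)
  then obtain w where w: "\<And>b. b \<in> B \<Longrightarrow> set (w b) \<subseteq> varset N"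
    and fold_w: "\<And>b. b \<in> B \<Longrightarrow> fold partial_deriv (w b) (bidet E) = b"
    by metis
  define \<psi> where "\<psi> = mpp.construct B (\<lambda>b. \<Phi> (w b))"
  have \<psi>: "mlinear \<psi>" unfolding \<psi>_def by (rule mpp.linear_construct[OF B(2)])
  have \<psi>_B: "\<psi> b = \<Phi> (w b)" if "b \<in> B" for b
    unfolding \<psi>_def using mpp.construct_basis[OF B(2) that] .
  have "inj_on \<psi> (mp.span B)"
  proof (subst mpp.linear_inj_on_iff_eq_0[OF \<psi> mp.subspace_span], intro ballI impI)
    fix x assume x: "x \<in> mp.span B" "\<psi> x = 0"
    define c where "c = mp.representation B x"
    define T where "T = {b. c b \<noteq> 0}"
    have T: "finite T" "T \<subseteq> B"
      unfolding T_def c_def using mp.finite_representation mp.representation_ne_zero by blast+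
    have x_eq: "x = (\<Sum>b\<in>T. mscale (c b) b)"
      using mp.sum_nonzero_representation_eq[OF B(2) x(1)] by (simp add: c_def T_def)
    have orbit0: "(\<Sum>b\<in>T. c b * (\<Prod>v\<leftarrow>w b. orbit_val E \<sigma> v)) = 0" if "\<sigma> \<in> P" for \<sigma>
    proof -
      have "\<psi> x = (\<Sum>b\<in>T. mscale (c b) (\<Phi> (w b)))"
        unfolding x_eq mpp.linear_sum[OF \<psi>] mpp.linear_scale[OF \<psi>]
        using T(2) \<psi>_B by (intro sum.cong) auto
      hence "Poly_Mapping.lookup (\<Sum>b\<in>T. mscale (c b) (\<Phi> (w b))) (Poly_Mapping.single \<sigma> 1) = 0"
        using x(2) by simp
      thus ?thesis using lookup_\<Phi>[OF that] by (simp add: lookup_sum)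
    qed
    show "x = 0"
    proof (cases "T = {}")
      case False
      \<comment> \<open>The longest words give the derivatives of lowest degree; their part
        \<open>z\<close> of the relation is nonzero by independence.\<close>
      define e where "e = Max ((\<lambda>b. length (w b)) ` T)"
      define T' where "T' = {b \<in> T. length (w b) = e}"
      have le_e: "length (w b) \<le> e" if "b \<in> T" for b using that T by (simp add: e_def)
      have "e \<in> (\<lambda>b. length (w b)) ` T" unfolding e_def using T False by (intro Max_in) auto
      then obtain b0 where b0: "b0 \<in> T'" by (auto simp: T'_def)
      define z where "z = (\<Sum>b\<in>T'. mscale (c b) b)"
      have "z \<noteq> 0"
        using mp.independentD[OF B(2), of T' c b0] b0 T by (auto simp: z_def T'_def T_def)
      then obtain m where m: "Poly_Mapping.lookup z m \<noteq> 0" by (metis poly_mapping_eqI lookup_zero)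
      obtain u where u: "mon_of u = m" using mon_of_surj by blast
      have "\<exists>b\<in>T'. Poly_Mapping.lookup b m \<noteq> 0"
        using m by (auto simp: z_def lookup_sum elim!: sum.not_neutral_contains_not_neutral)
      then obtain b1 where b1: "b1 \<in> T'" "Poly_Mapping.lookup b1 m \<noteq> 0" by blast
      have b1': "b1 \<in> B" "length (w b1) = e" using b1 T by (auto simp: T'_def)
      have "Poly_Mapping.lookup (bidet E) (m + mon_of (w b1)) \<noteq> 0"
        using lookup_fold_partial_deriv_nonzero fold_w[OF b1'(1)] b1(2) by metis
      then obtain \<pi> where \<pi>: "\<pi> permutes {..<N}" "m + mon_of (w b1) = detmon E \<pi>"
        using lookup_bidet_nonzero unfolding N_def by metis
      hence mon: "mon_of (u @ w b1) = detmon E \<pi>" by (simp add: u)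
      hence set_u: "set u \<subseteq> varset N"
        using keys_mon_of[of "u @ w b1"] eq_detmon_iff[of "detmon E \<pi>" E \<pi>] by (auto simp: N_def)
      have "length (u @ w b1) = (\<Sum>v\<in>varset N. Poly_Mapping.lookup (detmon E \<pi>) v)"
        unfolding mon[symmetric] using set_u w[OF b1'(1)] by (intro length_eq_sum_mon_of) auto
      \<comment> \<open>The degree of \<open>u\<close> complements \<open>e\<close> exactly, so
        every product \<open>w b @ u\<close> satisfies the degree bound needed for the alternating
        sum.\<close>
      hence len: "length u + e = bidegree E"
        using sum_detmon[of \<pi> E] \<pi>(1) b1'(2) by (simp add: N_def)
      \<comment> \<open>Shorter words yield monomials of degree below that of
        \<open>bidet E\<close>, which do not occur in it.\<close>
      have low: "Poly_Mapping.lookup (bidet E) (mon_of (w b @ u)) = 0" if "b \<in> T - T'" for b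
      proof (rule ccontr)
        assume "Poly_Mapping.lookup (bidet E) (mon_of (w b @ u)) \<noteq> 0"
        then obtain \<rho> where \<rho>: "\<rho> permutes {..<length E}" "mon_of (w b @ u) = detmon E \<rho>"
          by (rule lookup_bidet_nonzero)
        have "length (w b @ u) = (\<Sum>v\<in>varset N. Poly_Mapping.lookup (detmon E \<rho>) v)"
          unfolding \<rho>(2)[symmetric] using set_u w that T(2) by (intro length_eq_sum_mon_of) auto
        hence "length (w b) = e" using sum_detmon[OF \<rho>(1)] len by (simp add: N_def)
        thus False using that by (auto simp: T'_def)
      qed
      \<comment> \<open>The pairing is read in two stages: \<open>w b\<close> turns the determinant
        into \<open>b\<close>, and \<open>u\<close> then extracts the coefficient of
        \<open>m\<close>.\<close>
      have top: "mfact (mon_of (w b @ u)) * Poly_Mapping.lookup (bidet E) (mon_of (w b @ u))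
          = mfact m * Poly_Mapping.lookup b m" if "b \<in> B" for b
      proof -
        have "Poly_Mapping.lookup (fold partial_deriv (w b @ u) (bidet E)) 0
            = Poly_Mapping.lookup (fold partial_deriv u b) 0"
          using fold_w[OF that] by simp
        thus ?thesis unfolding lookup_fold_partial_deriv_0 u .
      qed
      have "0 = (\<Sum>\<sigma>\<in>P. of_int (sign \<sigma>) * (\<Prod>v\<leftarrow>u. orbit_val E \<sigma> v) * (\<Sum>b\<in>T. c b * (\<Prod>v\<leftarrow>w b. orbit_val E \<sigma> v)))"
        by (simp add: orbit0)
      also have "\<dots> = (\<Sum>b\<in>T. c b * (\<Sum>\<sigma>\<in>P. of_int (sign \<sigma>) * (\<Prod>v\<leftarrow>w b @ u. orbit_val E \<sigma> v)))"
        unfolding sum_distrib_left by (subst sum.swap) (simp add: mult_ac)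
      also have "\<dots> = (\<Sum>b\<in>T. c b * (mfact (mon_of (w b @ u)) * Poly_Mapping.lookup (bidet E) (mon_of (w b @ u))))"
      proof (intro sum.cong refl arg_cong2[of _ _ _ _ "(*)"])
        fix b assume "b \<in> T"
        hence "set (w b @ u) \<subseteq> varset (length E)" "length (w b @ u) \<le> bidegree E"
          using set_u w T(2) le_e[of b] len by (auto simp: N_def)
        thus "(\<Sum>\<sigma>\<in>P. of_int (sign \<sigma>) * (\<Prod>v\<leftarrow>w b @ u. orbit_val E \<sigma> v))
          = mfact (mon_of (w b @ u)) * Poly_Mapping.lookup (bidet E) (mon_of (w b @ u))"
          unfolding P_def N_def by (rule alternating_orbit_sum[OF E])
      qed
      also have "\<dots> = (\<Sum>b\<in>T'. c b * (mfact (mon_of (w b @ u)) * Poly_Mapping.lookup (bidet E) (mon_of (w b @ u))))"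
        using T low by (intro sum.mono_neutral_right) (auto simp: T'_def)
      also have "\<dots> = (\<Sum>b\<in>T'. c b * (mfact m * Poly_Mapping.lookup b m))"
        using top T by (intro sum.cong) (auto simp: T'_def)
      also have "\<dots> = mfact m * Poly_Mapping.lookup z m"
        by (simp add: z_def lookup_sum sum_distrib_left mult_ac)
      finally have "mfact m * Poly_Mapping.lookup z m = 0" by simp
      moreover have "mfact m \<noteq> 0" by (simp add: mfact_def)
      ultimately show ?thesis using m by simp
    qed (simp add: x_eq)
  qed
  hence ind: "mp.independent (\<psi> ` B)" and inj: "inj_on \<psi> B"
    using mpp.linear_independent_injective_image[OF \<psi> B(2)] inj_on_subset mp.span_superset by blast+
  have "\<psi> ` B \<subseteq> mp.span (Var ` P)"
  proof (rule image_subsetI)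
    fix b assume "b \<in> B"
    thus "\<psi> b \<in> mp.span (Var ` P)"
      unfolding \<psi>_B[OF \<open>b \<in> B\<close>] \<Phi>_def by (intro mp.span_sum mp.span_scale mp.span_base imageI)
  qed
  hence "finite (\<psi> ` B)" "card (\<psi> ` B) \<le> card (Var ` P :: (nat \<Rightarrow> nat) mpoly set)"
    using mp.independent_span_bound[OF finite_imageI[OF finP] ind] by blast+
  moreover have "card (Var ` P :: (nat \<Rightarrow> nat) mpoly set) \<le> fact N"
    using card_image_le[OF finP, of "Var :: _ \<Rightarrow> (nat \<Rightarrow> nat) mpoly"] card_permutations[of "{..<N}" N] by (simp add: P_def)
  ultimately have "finite B" "card B \<le> fact N"
    using inj finite_imageD by (auto simp: card_image)
  thus "finite_dim (bimodule E)" "mp.dim (bimodule E) \<le> fact (length E)"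
    using spanB mp.dim_span_eq_card_independent[OF B(2)] by (auto simp: finite_dim_def N_def)
qed

section \<open>The filtration by cells\<close>

text \<open>Permuting the variables permutes the rows; replacing \<open>\<pi>\<close> by
  \<open>\<pi> \<circ> \<sigma>\<close> in the Leibniz sum produces the sign.\<close>

lemma diag_action_bidet:
  assumes \<sigma>: "\<sigma> permutes {..<length E}"
  shows "diag_action \<sigma> (bidet E) = mscale (of_int (sign \<sigma>)) (bidet E)"
proof (rule poly_mapping_eqI)
  fix m
  have bij: "bij \<sigma>" using permutes_bij[OF \<sigma>] .
  have detmon: "detmon E (\<pi> \<circ> \<sigma>) = mperm \<sigma> (detmon E \<pi>)" for \<pi>
  proof (rule poly_mapping_eqI)
    fix v
    show "Poly_Mapping.lookup (detmon E (\<pi> \<circ> \<sigma>)) v = Poly_Mapping.lookup (mperm \<sigma> (detmon E \<pi>)) v"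
      using permutes_in_image[OF \<sigma>] by (cases v) (simp_all add: lookup_mperm[OF bij])
  qed
  have "Poly_Mapping.lookup (diag_action \<sigma> (bidet E)) m
      = (\<Sum>\<pi> | \<pi> permutes {..<length E}. if mperm \<sigma> m = detmon E (\<pi> \<circ> \<sigma>) then of_int (sign (\<pi> \<circ> \<sigma>)) else 0)"
    unfolding lookup_diag_action[OF bij] lookup_bidet by (rule sum_permutations_compose_right[OF \<sigma>])
  also have "\<dots> = (\<Sum>\<pi> | \<pi> permutes {..<length E}. of_int (sign \<sigma>) * (if m = detmon E \<pi> then of_int (sign \<pi>) else 0))"
  proof (intro sum.cong refl, clarify)
    fix \<pi> assume "\<pi> permutes {..<length E}"
    hence "sign (\<pi> \<circ> \<sigma>) = sign \<pi> * sign \<sigma>"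
      using \<sigma> by (intro sign_compose) (auto simp: permutation_permutes)
    thus "(if mperm \<sigma> m = detmon E (\<pi> \<circ> \<sigma>) then of_int (sign (\<pi> \<circ> \<sigma>)) else 0)
      = of_int (sign \<sigma>) * (if m = detmon E \<pi> then of_int (sign \<pi>) else (0 :: rat))"
      by (simp add: detmon mperm_inject[OF bij])
  qed
  finally show "Poly_Mapping.lookup (diag_action \<sigma> (bidet E)) m = Poly_Mapping.lookup (mscale (of_int (sign \<sigma>)) (bidet E)) m"
    by (simp add: lookup_bidet sum_distrib_left)
qed

section \<open>Stability of the module under permutations, derivatives and bidegree
  projections\<close>

lemma subspace_bimodule: "mp.subspace (bimodule E)"
  by (simp add: bimodule_def)

lemma biderivs_subset_bimodule: "biderivs E \<subseteq> bimodule E"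
  unfolding bimodule_def by (rule mp.span_superset)

lemma linear_image_bimodule_subset:
  assumes f: "mlinear f" and V: "mp.subspace V"
    and gen: "\<And>vs. set vs \<subseteq> varset (length E) \<Longrightarrow> f (fold partial_deriv vs (bidet E)) \<in> V"
  shows "f ` bimodule E \<subseteq> V"
proof -
  have "f ` biderivs E \<subseteq> V" using gen by (auto simp: biderivs_def)
  hence "mp.span (f ` biderivs E) \<subseteq> V" using V by (rule mp.span_minimal)
  thus ?thesis using mpp.linear_span_image[OF f] by (simp add: bimodule_def)
qed

lemma fold_partial_deriv_in_bimodule:
  "set vs \<subseteq> varset (length E) \<Longrightarrow> fold partial_deriv vs (bidet E) \<in> bimodule E"
  using biderivs_subset_bimodule by (auto simp: biderivs_def)

lemma diag_action_bimodule:
  assumes \<sigma>: "\<sigma> permutes {..<length E}"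
  shows "diag_action \<sigma> ` bimodule E \<subseteq> bimodule E"
proof (rule linear_image_bimodule_subset[OF _ subspace_bimodule])
  have bij: "bij \<sigma>" using permutes_bij[OF \<sigma>] .
  show "mlinear (diag_action \<sigma>)" by (rule mlinear_diag_action[OF bij])
  fix vs assume vs: "set vs \<subseteq> varset (length E)"
  have "vperm \<sigma> v \<in> varset (length E)" if "v \<in> set vs" for v
    using subsetD[OF vs that] permutes_in_image[OF \<sigma>] by (cases v) simp_all
  hence "fold partial_deriv (map (vperm \<sigma>) vs) (bidet E) \<in> bimodule E"
    by (intro fold_partial_deriv_in_bimodule) auto
  thus "diag_action \<sigma> (fold partial_deriv vs (bidet E)) \<in> bimodule E"
    unfolding diag_action_fold_partial_deriv[OF bij] diag_action_bidet[OF \<sigma>]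
      mpp.linear_scale[OF mlinear_fold_partial_deriv]
    by (rule mp.subspace_scale[OF subspace_bimodule])
qed

lemma partial_deriv_bimodule:
  assumes "v \<in> varset (length E)"
  shows "partial_deriv v ` bimodule E \<subseteq> bimodule E"
proof (rule linear_image_bimodule_subset[OF mlinear_partial_deriv subspace_bimodule])
  fix vs assume "set vs \<subseteq> varset (length E)"
  thus "partial_deriv v (fold partial_deriv vs (bidet E)) \<in> bimodule E"
    using fold_partial_deriv_in_bimodule[of "vs @ [v]" E] assms by simp
qed

lemma partial_deriv_funpow_bimodule:
  assumes "v \<in> varset (length E)" "P \<in> bimodule E"
  shows "(partial_deriv v ^^ k) P \<in> bimodule E"
  using partial_deriv_bimodule[OF assms(1)] assms(2) by (induction k) auto

lemma bihomogeneous_bidet: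
  "bihomogeneous (\<Sum>a<length E. fst (E ! a)) (\<Sum>a<length E. snd (E ! a)) (bidet E)"
  unfolding bihomogeneous_iff
proof (intro allI impI)
  fix m assume "Poly_Mapping.lookup (bidet E) m \<noteq> 0"
  then obtain \<pi> where \<pi>: "\<pi> permutes {..<length E}" "m = detmon E \<pi>"
    by (rule lookup_bidet_nonzero)
  have sums: "xdegree (\<Sum>a\<in>A. f a) = (\<Sum>a\<in>A. xdegree (f a))"
    "ydegree (\<Sum>a\<in>A. f a) = (\<Sum>a\<in>A. ydegree (f a))" if "finite A" for A and f :: "nat \<Rightarrow> _"
    using that by (induction A) (auto simp: xdegree_add ydegree_add, auto simp: xdegree_def ydegree_def)
  show "xdegree m = (\<Sum>a<length E. fst (E ! a)) \<and> ydegree m = (\<Sum>a<length E. snd (E ! a))"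
    using sum_nth_permutes[OF \<pi>(1), of fst E] sum_nth_permutes[OF \<pi>(1), of snd E]
    by (simp add: \<pi>(2) detmon_def sums xdegree_add ydegree_add xdegree_single ydegree_single)
qed

text \<open>The determinant is bihomogeneous, hence so is each generating derivative, and a
  projection either keeps it or sends it to 0.\<close>

lemma bicomp_bimodule: "bicomp h k ` bimodule E \<subseteq> bimodule E"
proof (rule linear_image_bimodule_subset[OF mlinear_bicomp subspace_bimodule])
  fix vs assume vs: "set vs \<subseteq> varset (length E)"
  have "\<exists>h k. bihomogeneous h k (fold partial_deriv vs P)" if "bihomogeneous h k P" for h k P
    using that
  proof (induction vs arbitrary: h k P)
    case (Cons v vs)
    show ?case using Cons.IH[OF bihomogeneous_partial_deriv[OF Cons.prems]] by simp
  qed auto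
  from this[OF bihomogeneous_bidet] obtain h' k' where "bihomogeneous h' k' (fold partial_deriv vs (bidet E))"
    by blast
  thus "bicomp h k (fold partial_deriv vs (bidet E)) \<in> bimodule E"
    using fold_partial_deriv_in_bimodule[OF vs] mp.subspace_0[OF subspace_bimodule]
    by (simp add: bicomp_bihomogeneous)
qed

lemma diag_action_bihom_part:
  assumes "bij \<sigma>" "diag_action \<sigma> ` W \<subseteq> W"
  shows "diag_action \<sigma> ` bihom_part h k W \<subseteq> bihom_part h k W"
  using assms bihomogeneous_diag_action by (auto simp: bihom_part_def)

lemma permutes_lessThan_Suc_fix:
  "\<pi> permutes {..<Suc n} \<and> \<pi> n = n \<longleftrightarrow> \<pi> permutes {..<n}"
proof
  assume "\<pi> permutes {..<Suc n} \<and> \<pi> n = n"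
  thus "\<pi> permutes {..<n}" by (auto intro: permutes_superset simp: less_Suc_eq)
next
  assume \<pi>: "\<pi> permutes {..<n}"
  thus "\<pi> permutes {..<Suc n} \<and> \<pi> n = n"
    using permutes_subset[OF \<pi>, of "{..<Suc n}"] permutes_not_in[OF \<pi>, of n] by auto
qed

text \<open>The last cell \<open>(A, B)\<close> is the maximum of the diagram, and \<open>n\<close>
  is both its position and the index of the last pair of variables. By
  \<open>linear_extension\<close> no cell is contained in an earlier one.\<close>

locale rectangle_extension =
  fixes E E' :: "(nat \<times> nat) list" and A B n :: nat
  assumes E_eq: "E = E' @ [(A, B)]"
    and n_eq: "n = length E'"
    and distinct_E: "distinct E"
    and set_E: "set E = {..A} \<times> {..B}"
    and linear_extension: "sorted_wrt (\<lambda>c d. \<not> (fst d \<le> fst c \<and> snd d \<le> snd c)) E"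
begin

lemma length_E: "length E = Suc n"
  by (simp add: E_eq n_eq)

lemma E_bound: "l < Suc n \<Longrightarrow> fst (E ! l) \<le> A \<and> snd (E ! l) \<le> B"
  using nth_mem[of l E] by (auto simp: set_E length_E mem_Times_iff)

lemma down_closed_E: "down_closed (set E)"
  by (auto simp: down_closed_def set_E)

text \<open>In a Leibniz term with exponents at least \<open>A\<close> and \<open>B\<close> in the
  last pair of variables, the permutation must assign the corner to \<open>n\<close>, hence fix
  \<open>n\<close>. Such permutations are those of the remaining indices, with the same
  sign.\<close>

lemma lookup_bidet_snoc:
  "Poly_Mapping.lookup (bidet E) (m + Poly_Mapping.single (X n) A + Poly_Mapping.single (Y n) B)
    = Poly_Mapping.lookup (bidet E') m"
proof -
  let ?e = "Poly_Mapping.single (X n) A + Poly_Mapping.single (Y n) B"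
  have nth_n: "E ! n = (A, B)" by (simp add: E_eq n_eq)
  have fix_n: "\<pi> n = n" if "\<pi> permutes {..<Suc n}" "m + ?e = detmon E \<pi>" for \<pi>
  proof -
    have lt: "\<pi> n < Suc n" using permutes_in_image[OF that(1), of n] by simp
    have "E ! \<pi> n = (Poly_Mapping.lookup (m + ?e) (X n), Poly_Mapping.lookup (m + ?e) (Y n))"
      using that(2) by (simp add: length_E)
    hence "fst (E ! \<pi> n) \<ge> A" "snd (E ! \<pi> n) \<ge> B" by (simp_all add: lookup_add)
    hence "E ! \<pi> n = E ! n" using E_bound[OF lt] nth_n by (auto simp: prod_eq_iff)
    thus ?thesis using nth_eq_iff_index_eq[OF distinct_E] lt by (simp add: length_E)
  qed
  have detmon: "detmon E \<pi> = detmon E' \<pi> + ?e" if "\<pi> permutes {..<n}" for \<pi>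
  proof -
    have "E ! \<pi> a = E' ! \<pi> a" if "a < n" for a
      using permutes_in_image[OF \<open>\<pi> permutes {..<n}\<close>, of a] that by (simp add: E_eq n_eq nth_append)
    moreover have "\<pi> n = n" using that permutes_lessThan_Suc_fix by blast
    ultimately show ?thesis
      by (simp add: detmon_def length_E nth_n flip: n_eq)
  qed
  have "Poly_Mapping.lookup (bidet E) (m + ?e)
      = (\<Sum>\<pi> | \<pi> permutes {..<Suc n}. if m + ?e = detmon E \<pi> then of_int (sign \<pi>) else 0)"
    by (simp add: lookup_bidet length_E)
  also have "\<dots> = (\<Sum>\<pi> | \<pi> permutes {..<n}. if m + ?e = detmon E \<pi> then of_int (sign \<pi>) else 0)"
  proof (rule sum.mono_neutral_right)
    show "{\<pi>. \<pi> permutes {..<n}} \<subseteq> {\<pi>. \<pi> permutes {..<Suc n}}"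
      using permutes_lessThan_Suc_fix by blast
    show "\<forall>\<pi>\<in>{\<pi>. \<pi> permutes {..<Suc n}} - {\<pi>. \<pi> permutes {..<n}}.
        (if m + ?e = detmon E \<pi> then of_int (sign \<pi>) else (0::rat)) = 0"
      using fix_n permutes_lessThan_Suc_fix by auto
  qed (simp add: finite_permutations)
  also have "\<dots> = (\<Sum>\<pi> | \<pi> permutes {..<n}. if m = detmon E' \<pi> then of_int (sign \<pi>) else 0)"
    by (intro sum.cong refl) (auto simp: detmon)
  finally show ?thesis by (simp add: lookup_bidet add.assoc flip: n_eq)
qed

lemma lookup_bidet_bound:
  assumes "Poly_Mapping.lookup (bidet E) m \<noteq> 0"
  shows "Poly_Mapping.lookup m (X n) \<le> A" "Poly_Mapping.lookup m (Y n) \<le> B"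
proof -
  obtain \<pi> where \<pi>: "\<pi> permutes {..<length E}" "m = detmon E \<pi>"
    using assms by (rule lookup_bidet_nonzero)
  have "\<pi> n < Suc n" using permutes_in_image[OF \<pi>(1), of n] by (simp add: length_E)
  thus "Poly_Mapping.lookup m (X n) \<le> A" "Poly_Mapping.lookup m (Y n) \<le> B"
    using E_bound by (simp_all add: \<pi>(2) length_E)
qed

definition D :: "nat \<Rightarrow> nat \<Rightarrow> xyvar mpoly \<Rightarrow> xyvar mpoly" where
  "D a b P = (partial_deriv (X n) ^^ a) ((partial_deriv (Y n) ^^ b) P)"

lemma mlinear_D: "mlinear (D a b)"
  using Vector_Spaces.linear_compose[OF mlinear_funpow[OF mlinear_partial_deriv[of "Y n"], of b]
    mlinear_funpow[OF mlinear_partial_deriv[of "X n"], of a]]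
  by (simp add: D_def[abs_def] comp_def)

lemma D_0_0: "D 0 0 P = P"
  by (simp add: D_def)

lemma D_D: "D a b (D a' b' P) = D (a + a') (b + b') P"
  by (simp add: D_def funpow_add partial_deriv_funpow_commute[of b "Y n"])

lemma D_fold: "D a b (fold partial_deriv vs P) = fold partial_deriv vs (D a b P)"
  by (simp add: D_def partial_deriv_funpow_fold_commute)

lemma lookup_D:
  "Poly_Mapping.lookup (D a b P) m
    = pochhammer (of_nat (Poly_Mapping.lookup m (X n) + 1)) a * pochhammer (of_nat (Poly_Mapping.lookup m (Y n) + 1)) b
      * Poly_Mapping.lookup P (m + Poly_Mapping.single (X n) a + Poly_Mapping.single (Y n) b)"
  by (simp add: D_def lookup_partial_deriv_funpow lookup_add lookup_single)

lemma D_bidet_eq_0: "a > A \<or> b > B \<Longrightarrow> D a b (bidet E) = 0"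
proof (rule poly_mapping_eqI, rule ccontr)
  fix m assume ab: "a > A \<or> b > B" and "Poly_Mapping.lookup (D a b (bidet E)) m \<noteq> Poly_Mapping.lookup 0 m"
  hence "Poly_Mapping.lookup (bidet E) (m + Poly_Mapping.single (X n) a + Poly_Mapping.single (Y n) b) \<noteq> 0"
    by (simp add: lookup_D)
  from lookup_bidet_bound[OF this] ab show False
    by (auto simp: lookup_add lookup_single)
qed

text \<open>No exponent of the last pair exceeds \<open>A\<close> and \<open>B\<close>, so only
  terms attaining both survive; the rising factorials become \<open>fact A\<close> and
  \<open>fact B\<close>.\<close>

lemma D_bidet_top: "D A B (bidet E) = mscale (fact A * fact B) (bidet E')"
proof (rule poly_mapping_eqI)
  fix m
  show "Poly_Mapping.lookup (D A B (bidet E)) m = Poly_Mapping.lookup (mscale (fact A * fact B) (bidet E')) m"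
  proof (cases "Poly_Mapping.lookup (bidet E') m = 0")
    case False
    then obtain \<pi> where "m = detmon E' \<pi>" by (rule lookup_bidet_nonzero)
    hence "Poly_Mapping.lookup m (X n) = 0" "Poly_Mapping.lookup m (Y n) = 0"
      by (simp_all add: n_eq)
    thus ?thesis by (simp add: lookup_D lookup_bidet_snoc flip: pochhammer_fact)
  qed (simp add: lookup_D lookup_bidet_snoc)
qed

lemma D_bimodule: "P \<in> bimodule E \<Longrightarrow> D a b P \<in> bimodule E"
  by (simp add: D_def partial_deriv_funpow_bimodule length_E)

lemma D_bicomp:
  "D a b (bicomp h k P) = (if a \<le> h \<and> b \<le> k then bicomp (h - a) (k - b) (D a b P) else 0)"
  by (intro poly_mapping_eqI)
    (auto simp: lookup_D lookup_bicomp xdegree_add ydegree_add xdegree_single ydegree_single)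

text \<open>The permutation fixes \<open>n\<close>, hence both variables in which \<open>D\<close>
  differentiates.\<close>

lemma D_diag_action:
  assumes "\<sigma> permutes {..<n}"
  shows "diag_action \<sigma> (D a b P) = D a b (diag_action \<sigma> P)"
  using permutes_not_in[OF assms, of n]
  by (simp add: D_def diag_action_funpow[OF permutes_bij[OF assms]])

abbreviation Dn :: "nat \<Rightarrow> xyvar mpoly \<Rightarrow> xyvar mpoly" where
  "Dn j \<equiv> D (fst (E ! j)) (snd (E ! j))"

definition filt :: "nat \<Rightarrow> xyvar mpoly set" where
  "filt k = {P \<in> bimodule E. \<forall>j. k \<le> j \<longrightarrow> j < Suc n \<longrightarrow> Dn j P = 0}"

lemma subspace_filt: "mp.subspace (filt k)"
  unfolding filt_def mp.subspace_def
  using subspace_bimodule[of E, unfolded mp.subspace_def]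
  by (simp add: mpp.linear_0[OF mlinear_D] mpp.linear_add[OF mlinear_D] mpp.linear_scale[OF mlinear_D])

lemma finite_dim_E: "finite_dim (bimodule E)"
  using finite_dim_bimodule[OF distinct_E down_closed_E] by simp

lemma finite_dim_filt: "finite_dim (filt k)"
  by (rule finite_dim_subset[OF finite_dim_E]) (auto simp: filt_def)

lemma filt_top: "filt (Suc n) = bimodule E"
  by (auto simp: filt_def)

text \<open>By the linear extension property the cell \<open>(0, 0)\<close> comes first, and its
  operator is the identity.\<close>

lemma filt_0: "filt 0 = {0}"
proof -
  have "(0, 0) \<in> set E" by (simp add: set_E)
  then obtain j where j: "j < length E" "E ! j = (0, 0)" by (metis in_set_conv_nth)
  have "j = 0"
    using sorted_wrt_nth_less[OF linear_extension, of 0 j] j by (cases j) auto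
  hence "P = 0" if "P \<in> filt 0" for P
    using that j by (auto simp: filt_def D_0_0 dest!: spec[of _ 0])
  thus ?thesis using mp.subspace_0[OF subspace_filt[of 0]] by auto
qed

lemma filt_kernel: "k < Suc n \<Longrightarrow> {P \<in> filt (Suc k). Dn k P = 0} = filt k"
  by (auto simp: filt_def) (metis Suc_leI le_neq_implies_less)

text \<open>For the cell \<open>(a, b)\<close> at position \<open>k\<close>, the complementary
  operator \<open>D (A - a) (B - b)\<close> applied to \<open>bidet E\<close> is completed by
  \<open>Dn k\<close> to the corner operator, which gives \<open>bidet E'\<close>. Every other
  derivative of \<open>bidet E'\<close> follows, as the operators commute.\<close>

lemma bimodule_subset_image_filt:
  assumes k: "k < Suc n"
  shows "bimodule E' \<subseteq> Dn k ` filt (Suc k)"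
proof -
  obtain a b where ab: "E ! k = (a, b)" by (cases "E ! k")
  have le: "a \<le> A" "b \<le> B" using E_bound[OF k] ab by auto
  have "(\<lambda>Q. Q) ` bimodule E' \<subseteq> Dn k ` filt (Suc k)"
  proof (rule linear_image_bimodule_subset[OF mp.linear_ident mpp.linear_subspace_image[OF mlinear_D subspace_filt]])
    fix vs assume vs: "set vs \<subseteq> varset (length E')"
    \<comment> \<open>The scalar cancels the constant of \<open>D_bidet_top\<close>.\<close>
    define P where "P = mscale (1 / (fact A * fact B)) (fold partial_deriv vs (D (A - a) (B - b) (bidet E)))"
    have DP: "D a' b' P = mscale (1 / (fact A * fact B)) (fold partial_deriv vs (D (a' + (A - a)) (b' + (B - b)) (bidet E)))"
      for a' b'
      by (simp add: P_def mpp.linear_scale[OF mlinear_D] D_fold D_D)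
    have "set vs \<subseteq> varset (length E)"
      using vs by (auto simp: varset_def E_eq)
    hence "P \<in> bimodule E"
      unfolding P_def D_fold[symmetric]
      by (intro mp.subspace_scale[OF subspace_bimodule] D_bimodule fold_partial_deriv_in_bimodule)
    moreover have "Dn j P = 0" if "Suc k \<le> j" "j < Suc n" for j
    proof -
      \<comment> \<open>A later cell exceeds \<open>(a, b)\<close> in some coordinate, so combined
        with the complement it leaves the rectangle and kills the determinant.\<close>
      have "\<not> (fst (E ! j) \<le> a \<and> snd (E ! j) \<le> b)"
        using sorted_wrt_nth_less[OF linear_extension, of k j] that ab by (simp add: length_E)
      hence "fst (E ! j) + (A - a) > A \<or> snd (E ! j) + (B - b) > B" using le by auto
      thus ?thesis
        unfolding DP by (simp add: D_bidet_eq_0 mpp.linear_0[OF mlinear_fold_partial_deriv])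
    qed
    ultimately have "P \<in> filt (Suc k)" by (simp add: filt_def)
    moreover have "fold partial_deriv vs (bidet E') = Dn k P"
      using le by (simp add: ab DP D_bidet_top mpp.linear_scale[OF mlinear_fold_partial_deriv])
    ultimately show "fold partial_deriv vs (bidet E') \<in> Dn k ` filt (Suc k)" by blast
  qed
  thus ?thesis by simp
qed

end

section \<open>Equality of dimensions and the graded trace formula\<close>

locale rectangle_extension_fact = rectangle_extension +
  assumes dim_E': "mp.dim (bimodule E') = fact n"
begin

text \<open>The \<open>Suc n\<close> layers have dimension at least \<open>fact n\<close> each,
  while their sum is at most \<open>fact (Suc n)\<close> by the orbit bound. So every inequality is
  an equality, which gives the total dimension and identifies each layer.\<close>

lemma dim_E_image_filt:
  "mp.dim (bimodule E) = fact (Suc n)"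
  "k < Suc n \<Longrightarrow> Dn k ` filt (Suc k) = bimodule E'"
proof -
  define g where "g k = mp.dim (Dn k ` filt (Suc k))" for k
  have fin: "finite_dim (Dn k ` filt (Suc k))" for k
    by (rule finite_dim_image[OF finite_dim_filt mlinear_D])
  have g_ge: "fact n \<le> g k" if "k < Suc n" for k
    using dim_mono[OF bimodule_subset_image_filt[OF that] fin] by (simp add: g_def dim_E')
  have dim_filt: "k \<le> Suc n \<Longrightarrow> mp.dim (filt k) = (\<Sum>i<k. g i)" for k
  proof (induction k)
    case 0
    show ?case
      using mp.dim_span[of "{} :: xyvar mpoly set"] mp.dim_eq_card_independent[of "{} :: xyvar mpoly set"] mp.independent_empty by (simp add: filt_0)
  next
    case (Suc k)
    have "mp.dim (filt (Suc k)) = mp.dim {P \<in> filt (Suc k). Dn k P = 0} + g k"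
      unfolding g_def by (rule dim_kernel_image[OF subspace_filt finite_dim_filt mlinear_D])
    thus ?case using Suc filt_kernel[of k] by simp
  qed
  have sum_ge: "(\<Sum>i<Suc n. fact n) \<le> (\<Sum>i<Suc n. g i)"
    by (rule sum_mono) (use g_ge in auto)
  have dim_le: "mp.dim (bimodule E) \<le> fact (Suc n)"
    using finite_dim_bimodule(2)[OF distinct_E down_closed_E] by (simp add: length_E)
  have dim_eq: "mp.dim (bimodule E) = (\<Sum>i<Suc n. g i)"
    using dim_filt[of "Suc n"] by (simp add: filt_top)
  have eq: "(\<Sum>i<Suc n. fact n) = (\<Sum>i<Suc n. g i)"
    using sum_ge dim_le unfolding dim_eq by simp
  show "mp.dim (bimodule E) = fact (Suc n)"
    unfolding dim_eq eq[symmetric] by simp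
  assume k: "k < Suc n"
  have "fact n = g k"
    by (rule sum_mono_inv[OF eq]) (use g_ge k in auto)
  thus "Dn k ` filt (Suc k) = bimodule E'"
    using subspace_dim_equal[OF bimodule_subset_image_filt[OF k] subspace_bimodule fin]
    by (simp add: g_def dim_E')
qed

lemma bicomp_filt: "P \<in> filt j \<Longrightarrow> bicomp h k P \<in> filt j"
  using bicomp_bimodule[of h k E] by (auto simp: filt_def D_bicomp mpp.linear_0[OF mlinear_bicomp])

text \<open>The operator lowers the bidegree by the cell. A preimage of a bihomogeneous element may
  be replaced by its component of bidegree \<open>(h, k)\<close>, which stays in the filtration; if
  the cell is not below \<open>(h, k)\<close>, both sides are zero.\<close>

lemma image_bihom_part_filt:
  assumes j: "j < Suc n"
  shows "Dn j ` bihom_part h k (filt (Suc j))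
    = (if fst (E ! j) \<le> h \<and> snd (E ! j) \<le> k
       then bihom_part (h - fst (E ! j)) (k - snd (E ! j)) (bimodule E') else {0})" (is "?L = ?R")
proof (rule equalityI; rule subsetI)
  fix Q assume "Q \<in> ?L"
  then obtain P where P: "P \<in> filt (Suc j)" "bihomogeneous h k P" "Q = Dn j P"
    by (auto simp: bihom_part_def)
  have "Q = Dn j (bicomp h k P)" using P by (simp add: bicomp_bihomogeneous)
  moreover have "Q \<in> bimodule E'" using P dim_E_image_filt(2)[OF j] by blast
  ultimately show "Q \<in> ?R"
    using bihomogeneous_bicomp[of "h - fst (E ! j)" "k - snd (E ! j)"]
    by (auto simp: D_bicomp bihom_part_def split: if_splits)
next
  fix Q assume Q: "Q \<in> ?R"
  show "Q \<in> ?L"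
  proof (cases "fst (E ! j) \<le> h \<and> snd (E ! j) \<le> k")
    case True
    hence Q: "Q \<in> bimodule E'" "bihomogeneous (h - fst (E ! j)) (k - snd (E ! j)) Q"
      using Q by (auto simp: bihom_part_def)
    then obtain P where P: "P \<in> filt (Suc j)" "Q = Dn j P" using dim_E_image_filt(2)[OF j] by blast
    have "Dn j (bicomp h k P) = Q"
      using True P(2) Q(2) by (simp add: D_bicomp bicomp_bihomogeneous)
    thus ?thesis using bicomp_filt[OF P(1)] bihomogeneous_bicomp by (force simp: bihom_part_def)
  next
    case False
    hence "Q = 0" using Q by (simp split: if_splits)
    moreover have "0 \<in> bihom_part h k (filt (Suc j))"
      by (rule mp.subspace_0[OF subspace_bihom_part[OF subspace_filt]])
    ultimately show ?thesis using mpp.linear_0[OF mlinear_D] by (metis image_eqI)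
  qed
qed

text \<open>Additivity of the trace telescopes along the filtration, the layer at position
  \<open>j\<close> contributing the trace on its image under \<open>Dn j\<close>.\<close>

lemma trace_bihom_part:
  assumes \<sigma>: "\<sigma> permutes {..<n}"
  shows "trace_on (bihom_part h k (bimodule E)) (diag_action \<sigma>)
    = (\<Sum>c\<leftarrow>E. if fst c \<le> h \<and> snd c \<le> k
        then trace_on (bihom_part (h - fst c) (k - snd c) (bimodule E')) (diag_action \<sigma>) else 0)"
proof -
  have bij: "bij \<sigma>" using permutes_bij[OF \<sigma>] .
  have \<sigma>': "\<sigma> permutes {..<length E}" using \<sigma> permutes_lessThan_Suc_fix length_E by metis
  define tr where "tr c = (if fst c \<le> h \<and> snd c \<le> k
    then trace_on (bihom_part (h - fst c) (k - snd c) (bimodule E')) (diag_action \<sigma>) else 0)" for c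
  have inv: "diag_action \<sigma> ` filt j \<subseteq> filt j" for j
    using diag_action_bimodule[OF \<sigma>']
    by (auto simp: filt_def simp flip: D_diag_action[OF \<sigma>] intro: mpp.linear_0[OF mlinear_diag_action[OF bij]])
  have "j \<le> Suc n \<Longrightarrow> trace_on (bihom_part h k (filt j)) (diag_action \<sigma>) = (\<Sum>i<j. tr (E ! i))" for j
  proof (induction j)
    case 0
    have "bihom_part h k {0} = {0}"
      by (auto simp: bihom_part_def bihomogeneous_def)
    then show ?case by (simp add: filt_0)
  next
    case (Suc j)
    have ker: "{P \<in> bihom_part h k (filt (Suc j)). Dn j P = 0} = bihom_part h k (filt j)"
      using filt_kernel[of j] Suc.prems by (auto simp: bihom_part_def)
    have "trace_on (bihom_part h k (filt (Suc j))) (diag_action \<sigma>)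
      = trace_on {P \<in> bihom_part h k (filt (Suc j)). Dn j P = 0} (diag_action \<sigma>)
        + trace_on (Dn j ` bihom_part h k (filt (Suc j))) (diag_action \<sigma>)"
    proof (rule trace_on_exact)
      show "finite_dim (bihom_part h k (filt (Suc j)))"
        by (rule finite_dim_subset[OF finite_dim_filt]) (auto simp: bihom_part_def)
    qed (auto intro!: subspace_bihom_part subspace_filt mlinear_diag_action[OF bij] mlinear_D
        D_diag_action[OF \<sigma>, symmetric] dest: subsetD[OF diag_action_bihom_part[OF bij inv], OF imageI])
    also have "trace_on (Dn j ` bihom_part h k (filt (Suc j))) (diag_action \<sigma>) = tr (E ! j)"
      using image_bihom_part_filt[of j h k] Suc.prems by (simp add: tr_def)
    finally show ?case using Suc ker by simp
  qed
  from this[of "Suc n"] show ?thesis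
    by (simp add: filt_top sum_list_sum_nth length_E atLeast0LessThan flip: tr_def)
qed

end

section \<open>Frobenius characteristics\<close>

lemma partial_deriv_single:
  "partial_deriv v (Poly_Mapping.single m c)
    = Poly_Mapping.single (m - Poly_Mapping.single v 1) (of_nat (Poly_Mapping.lookup m v) * c)"
  by (simp add: partial_deriv_def)

lemma poly_mapping_sum_single:
  "P = (\<Sum>m\<in>Poly_Mapping.keys P. Poly_Mapping.single m (Poly_Mapping.lookup P m))"
  by (rule poly_mapping_eqI) (simp add: lookup_sum lookup_single when_def sum.delta in_keys_iff)

lemma partial_deriv_mult:
  "partial_deriv v (P * Q) = partial_deriv v P * Q + P * partial_deriv v Q"
proof -
  let ?e = "Poly_Mapping.single v (1::nat)"
  have single: "partial_deriv v (Poly_Mapping.single m c * Poly_Mapping.single m' d)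
    = partial_deriv v (Poly_Mapping.single m c) * Poly_Mapping.single m' d
      + Poly_Mapping.single m c * partial_deriv v (Poly_Mapping.single m' d)" for m m' c d
  proof -
    \<comment> \<open>Truncated subtraction commutes with addition only if \<open>v\<close> occurs;
      in the other case the coefficient is 0.\<close>
    have minus: "a - ?e + b = a + b - ?e" if "Poly_Mapping.lookup a v \<noteq> 0" for a b
      using that by (intro poly_mapping_eqI) (auto simp: lookup_add lookup_minus lookup_single when_def)
    have 1: "Poly_Mapping.single (m - ?e + m') (of_nat (Poly_Mapping.lookup m v) * c * d)
      = Poly_Mapping.single (m + m' - ?e) (of_nat (Poly_Mapping.lookup m v) * c * d)"
      using minus[of m m'] by (cases "Poly_Mapping.lookup m v = 0") simp_all
    have 2: "Poly_Mapping.single (m + (m' - ?e)) (c * (of_nat (Poly_Mapping.lookup m' v) * d))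
      = Poly_Mapping.single (m + m' - ?e) (c * (of_nat (Poly_Mapping.lookup m' v) * d))"
      using minus[of m' m] by (cases "Poly_Mapping.lookup m' v = 0") (simp_all add: add.commute)
    show ?thesis
      unfolding mult_single partial_deriv_single 1 2 single_add[symmetric]
      by (simp add: lookup_add algebra_simps)
  qed
  have "partial_deriv v ((\<Sum>m\<in>A. Poly_Mapping.single m (f m)) * (\<Sum>m\<in>B. Poly_Mapping.single m (g m)))
    = partial_deriv v (\<Sum>m\<in>A. Poly_Mapping.single m (f m)) * (\<Sum>m\<in>B. Poly_Mapping.single m (g m))
      + (\<Sum>m\<in>A. Poly_Mapping.single m (f m)) * partial_deriv v (\<Sum>m\<in>B. Poly_Mapping.single m (g m))"
    for A B f g
    by (simp only: sum_product mpp.linear_sum[OF mlinear_partial_deriv] single sum.distrib)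
  from this[of "Poly_Mapping.lookup P" "Poly_Mapping.keys P" "Poly_Mapping.lookup Q" "Poly_Mapping.keys Q"]
  show ?thesis unfolding poly_mapping_sum_single[symmetric] .
qed

lemma partial_deriv_Var: "partial_deriv v (Var w) = (if v = w then 1 else 0)"
  by (simp add: Var_def partial_deriv_single lookup_single when_def)

lemma partial_deriv_one: "partial_deriv v 1 = 0"
  using partial_deriv_single[of v 0 1] by simp

lemma partial_deriv_Var_power: "v \<noteq> w \<Longrightarrow> partial_deriv v (Var w ^ k) = 0"
  by (induction k) (simp_all add: partial_deriv_mult partial_deriv_Var partial_deriv_one)

lemma partial_deriv_Var_power_mult:
  assumes "v \<noteq> u" "v \<noteq> w"
  shows "partial_deriv v (Var u ^ h * Var w ^ k * P) = Var u ^ h * Var w ^ k * partial_deriv v P"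
  using assms by (simp add: partial_deriv_mult partial_deriv_Var_power)

lemma power_sum_add_mset: "power_sum (add_mset k \<rho>) = Var (PSum k) * power_sum \<rho>"
  by (simp add: power_sum_def)

lemma partial_deriv_power_sum:
  "partial_deriv (PSum k) (power_sum \<rho>) = of_nat (count \<rho> k) * power_sum (\<rho> - {#k#})"
proof (induction \<rho>)
  case empty
  then show ?case by (simp add: power_sum_def partial_deriv_one)
next
  case (add j \<rho>)
  show ?case
  proof (cases "j = k")
    case True
    have "of_nat (count \<rho> k) * (Var (PSum k) * power_sum (\<rho> - {#k#})) = of_nat (count \<rho> k) * power_sum \<rho>"
      by (cases "k \<in># \<rho>") (auto simp: not_in_iff simp flip: power_sum_add_mset)
    thus ?thesis
      using True add by (simp add: power_sum_add_mset partial_deriv_mult partial_deriv_Var algebra_simps)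
  next
    case False
    have "power_sum (add_mset j \<rho> - {#k#}) = Var (PSum j) * power_sum (\<rho> - {#k#})"
      using False by (simp add: add_mset_diff_bothsides diff_union_swap2 flip: power_sum_add_mset)
    thus ?thesis
      using False add by (simp add: power_sum_add_mset partial_deriv_mult partial_deriv_Var algebra_simps)
  qed
qed

section \<open>Cycle types, fixed points and conjugation\<close>

lemma orbit_fixpoint: "\<sigma> i = i \<Longrightarrow> orbit \<sigma> i = {i}"
proof -
  assume i: "\<sigma> i = i"
  have "y = i" if "y \<in> orbit \<sigma> i" for y
    using that by induction (simp_all add: i)
  moreover have "i \<in> orbit \<sigma> i" using orbit.base[of \<sigma> i] i by simp
  ultimately show ?thesis by auto
qed

lemma permutes_self_in_orbit:
  assumes "\<sigma> permutes {..<N :: nat}"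
  shows "i \<in> orbit \<sigma> i"
  using assms by (intro permutation_self_in_orbit) (auto simp: permutation_permutes)

lemma card_orbit_eq_1_iff:
  assumes "\<sigma> permutes {..<N :: nat}"
  shows "card (orbit \<sigma> i) = 1 \<longleftrightarrow> \<sigma> i = i"
proof
  assume "card (orbit \<sigma> i) = 1"
  then obtain x where "orbit \<sigma> i = {x}" by (rule card_1_singletonE)
  thus "\<sigma> i = i" using permutes_self_in_orbit[OF assms, of i] orbit.base[of \<sigma> i] by auto
qed (simp add: orbit_fixpoint)

lemma count_cycle_type_1:
  assumes "\<sigma> permutes {..<N}"
  shows "count (cycle_type N \<sigma>) 1 = card {i\<in>{..<N}. \<sigma> i = i}"
proof -
  have "count (cycle_type N \<sigma>) 1 = card {S \<in> orbit \<sigma> ` {..<N}. card S = 1}"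
    unfolding cycle_type_def by (subst count_image_mset) (auto simp: vimage_def intro: arg_cong[of _ _ card])
  also have "{S \<in> orbit \<sigma> ` {..<N}. card S = 1} = (\<lambda>i. {i}) ` {i\<in>{..<N}. \<sigma> i = i}"
    using card_orbit_eq_1_iff[OF assms] by (force simp: orbit_fixpoint image_iff)
  also have "card \<dots> = card {i\<in>{..<N}. \<sigma> i = i}"
    by (rule card_image) auto
  finally show ?thesis .
qed

text \<open>One inclusion is shown for arbitrary permutation maps and then applied to the conjugate
  for the converse. Involutions suffice because only transpositions will conjugate.\<close>

lemma orbit_involution_conj:
  assumes "\<tau> \<circ> \<tau> = id"
  shows "orbit (\<tau> \<circ> \<sigma> \<circ> \<tau>) (\<tau> x) = \<tau> ` orbit \<sigma> x"
proof -
  have \<tau>: "\<tau> (\<tau> y) = y" for y using assms by (metis comp_apply id_apply)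
  have sub: "\<tau> ` orbit \<rho> y \<subseteq> orbit (\<tau> \<circ> \<rho> \<circ> \<tau>) (\<tau> y)" for \<rho> y
  proof (rule image_subsetI)
    fix z assume "z \<in> orbit \<rho> y"
    thus "\<tau> z \<in> orbit (\<tau> \<circ> \<rho> \<circ> \<tau>) (\<tau> y)"
    proof induction
      case base
      have "(\<tau> \<circ> \<rho> \<circ> \<tau>) (\<tau> y) = \<tau> (\<rho> y)" by (simp add: \<tau>)
      thus ?case using orbit.base[of "\<tau> \<circ> \<rho> \<circ> \<tau>" "\<tau> y"] by metis
    next
      case (step z)
      have "(\<tau> \<circ> \<rho> \<circ> \<tau>) (\<tau> z) = \<tau> (\<rho> z)" by (simp add: \<tau>)
      thus ?case using orbit.step[OF step.IH] by metis
    qed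
  qed
  have "\<tau> \<circ> (\<tau> \<circ> \<sigma> \<circ> \<tau>) \<circ> \<tau> = \<sigma>" by (simp add: fun_eq_iff \<tau>)
  hence "\<tau> ` orbit (\<tau> \<circ> \<sigma> \<circ> \<tau>) (\<tau> x) \<subseteq> orbit \<sigma> x"
    using sub[of "\<tau> \<circ> \<sigma> \<circ> \<tau>" "\<tau> x"] by (simp add: \<tau>)
  hence "\<tau> ` \<tau> ` orbit (\<tau> \<circ> \<sigma> \<circ> \<tau>) (\<tau> x) \<subseteq> \<tau> ` orbit \<sigma> x" by (rule image_mono)
  thus ?thesis using sub[of \<sigma> x] by (simp add: image_image \<tau>)
qed

lemma cycle_type_involution_conj:
  assumes "\<tau> permutes {..<N}" "\<tau> \<circ> \<tau> = id"
  shows "cycle_type N (\<tau> \<circ> \<sigma> \<circ> \<tau>) = cycle_type N \<sigma>"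
proof -
  have inj: "inj \<tau>" using permutes_inj[OF assms(1)] .
  have "orbit (\<tau> \<circ> \<sigma> \<circ> \<tau>) ` {..<N} = orbit (\<tau> \<circ> \<sigma> \<circ> \<tau>) ` \<tau> ` {..<N}"
    using permutes_image[OF assms(1)] by simp
  also have "\<dots> = image \<tau> ` orbit \<sigma> ` {..<N}"
    unfolding image_image by (simp add: orbit_involution_conj[OF assms(2)])
  finally have "mset_set (orbit (\<tau> \<circ> \<sigma> \<circ> \<tau>) ` {..<N}) = image_mset (image \<tau>) (mset_set (orbit \<sigma> ` {..<N}))"
    using inj by (simp add: image_mset_mset_set inj_image_eq_iff inj_on_def)
  moreover have "card (\<tau> ` S) = card S" for S
    using inj by (intro card_image) (auto intro: inj_on_subset)
  ultimately show ?thesis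
    by (simp add: cycle_type_def image_mset.compositionality comp_def)
qed

text \<open>The index \<open>n\<close> is fixed and forms a new orbit of size 1.\<close>

lemma cycle_type_Suc:
  assumes "\<sigma> permutes {..<n}"
  shows "cycle_type (Suc n) \<sigma> = add_mset 1 (cycle_type n \<sigma>)"
proof -
  have "orbit \<sigma> n = {n}" using permutes_not_in[OF assms, of n] by (simp add: orbit_fixpoint)
  moreover have "{n} \<notin> orbit \<sigma> ` {..<n}"
    using permutes_self_in_orbit[OF assms] by force
  ultimately show ?thesis by (simp add: cycle_type_def lessThan_Suc)
qed

lemma of_nat_mult_eq_sum_const:
  "finite A \<Longrightarrow> of_nat (card A) * P = (\<Sum>i\<in>A. P)"
  for P :: "'a :: comm_semiring_1"
  by simp

text \<open>Differentiating a power sum product by p_1 counts the fixed points of the permutation,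
  so the sum runs over pairs of a permutation and a fixed point \<open>i\<close>. Conjugation moves
  \<open>i\<close> to \<open>n\<close>; every \<open>i\<close> thus gives the same sum over
  permutations of \<open>n\<close> letters, and the factor n + 1 cancels in the factorial.\<close>

lemma partial_deriv_frobenius:
  assumes class_fun: "\<And>\<sigma> \<tau>. \<sigma> permutes {..<Suc n} \<Longrightarrow> \<tau> permutes {..<Suc n} \<Longrightarrow> \<tau> \<circ> \<tau> = id
    \<Longrightarrow> \<chi> (\<tau> \<circ> \<sigma> \<circ> \<tau>) = \<chi> \<sigma>"
  shows "partial_deriv (PSum 1) (frobenius (Suc n) \<chi>) = frobenius n \<chi>"
proof -
  define S where "S = {\<sigma>. \<sigma> permutes {..<Suc n}}"
  have finS: "finite S" by (simp add: S_def finite_permutations)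
  define F where "F \<sigma> = mscale (\<chi> \<sigma>) (power_sum (cycle_type (Suc n) \<sigma> - {#1#}))" for \<sigma>
  have deriv: "partial_deriv (PSum 1) (mscale (\<chi> \<sigma>) (power_sum (cycle_type (Suc n) \<sigma>)))
      = (\<Sum>i<Suc n. if \<sigma> i = i then F \<sigma> else 0)" if "\<sigma> \<in> S" for \<sigma>
  proof -
    have "partial_deriv (PSum 1) (mscale (\<chi> \<sigma>) (power_sum (cycle_type (Suc n) \<sigma>)))
      = mscale (\<chi> \<sigma>) (of_nat (card {i\<in>{..<Suc n}. \<sigma> i = i}) * power_sum (cycle_type (Suc n) \<sigma> - {#1#}))"
      using that by (simp add: mpp.linear_scale[OF mlinear_partial_deriv] partial_deriv_power_sum S_def
          count_cycle_type_1[of \<sigma> "Suc n", unfolded One_nat_def])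
    also have "\<dots> = of_nat (card {i\<in>{..<Suc n}. \<sigma> i = i}) * F \<sigma>"
      by (simp add: F_def mscale_def mult_ac)
    also have "\<dots> = (\<Sum>i\<in>{i\<in>{..<Suc n}. \<sigma> i = i}. F \<sigma>)"
      by (rule of_nat_mult_eq_sum_const) simp
    also have "\<dots> = (\<Sum>i<Suc n. if \<sigma> i = i then F \<sigma> else 0)"
      by (rule sum.inter_filter) simp
    finally show ?thesis .
  qed
  have inner: "(\<Sum>\<sigma>\<in>S. if \<sigma> i = i then F \<sigma> else 0)
      = (\<Sum>\<sigma> | \<sigma> permutes {..<n}. mscale (\<chi> \<sigma>) (power_sum (cycle_type n \<sigma>)))" if "i < Suc n" for i
  proof -
    \<comment> \<open>For \<open>i = n\<close> this is the identity, which is also an involution in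
      the sense used.\<close>
    define \<tau> where "\<tau> = Transposition.transpose i n"
    have \<tau>: "\<tau> permutes {..<Suc n}" "\<tau> \<circ> \<tau> = id"
      using that by (auto simp: \<tau>_def permutes_swap_id)
    have \<tau>_simps: "\<tau> n = i" "\<tau> i = n" "\<tau> (\<tau> x) = x" for x
      using \<tau>(2) by (auto simp: \<tau>_def)
    have cancel: "\<tau> \<circ> (\<tau> \<circ> \<sigma> \<circ> \<tau>) \<circ> \<tau> = \<sigma>" for \<sigma> by (simp add: fun_eq_iff \<tau>_simps)
    have conj_S: "\<tau> \<circ> \<sigma> \<circ> \<tau> permutes {..<Suc n}" if "\<sigma> permutes {..<Suc n}" for \<sigma>
      using \<tau>(1) that by (intro permutes_compose)
    have "(\<Sum>\<sigma>\<in>S. if \<sigma> i = i then F \<sigma> else 0) = (\<Sum>\<sigma>\<in>{\<sigma>\<in>S. \<sigma> i = i}. F \<sigma>)"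
      by (rule sum.inter_filter[symmetric, OF finS])
    also have "\<dots> = (\<Sum>\<sigma> | \<sigma> permutes {..<n}. mscale (\<chi> \<sigma>) (power_sum (cycle_type n \<sigma>)))"
    proof (rule sum.reindex_bij_witness[of _ "\<lambda>\<sigma>. \<tau> \<circ> \<sigma> \<circ> \<tau>" "\<lambda>\<sigma>. \<tau> \<circ> \<sigma> \<circ> \<tau>"])
      fix \<sigma> assume \<sigma>: "\<sigma> \<in> {\<sigma> \<in> S. \<sigma> i = i}"
      show "\<tau> \<circ> (\<tau> \<circ> \<sigma> \<circ> \<tau>) \<circ> \<tau> = \<sigma>" by (rule cancel)
      have perm: "\<tau> \<circ> \<sigma> \<circ> \<tau> permutes {..<n}"
        using \<sigma> conj_S[of \<sigma>] permutes_lessThan_Suc_fix[of "\<tau> \<circ> \<sigma> \<circ> \<tau>" n] by (simp add: S_def \<tau>_simps)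
      thus "\<tau> \<circ> \<sigma> \<circ> \<tau> \<in> {\<sigma>. \<sigma> permutes {..<n}}" by simp
      have "cycle_type (Suc n) \<sigma> - {#1#} = cycle_type n (\<tau> \<circ> \<sigma> \<circ> \<tau>)"
        using cycle_type_Suc[OF perm] cycle_type_involution_conj[OF \<tau>, of \<sigma>] by simp
      thus "mscale (\<chi> (\<tau> \<circ> \<sigma> \<circ> \<tau>)) (power_sum (cycle_type n (\<tau> \<circ> \<sigma> \<circ> \<tau>))) = F \<sigma>"
        using \<sigma> class_fun[OF _ \<tau>, of \<sigma>] by (simp add: F_def S_def)
    next
      fix \<sigma> assume \<sigma>: "\<sigma> \<in> {\<sigma>. \<sigma> permutes {..<n}}"
      show "\<tau> \<circ> (\<tau> \<circ> \<sigma> \<circ> \<tau>) \<circ> \<tau> = \<sigma>" by (rule cancel)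
      have "\<sigma> permutes {..<Suc n}" "\<sigma> n = n"
        using \<sigma> permutes_lessThan_Suc_fix[of \<sigma> n] by auto
      thus "\<tau> \<circ> \<sigma> \<circ> \<tau> \<in> {\<sigma> \<in> S. \<sigma> i = i}"
        using conj_S[of \<sigma>] by (simp add: S_def \<tau>_simps)
    qed
    finally show ?thesis .
  qed
  define Z where "Z = (\<Sum>\<sigma> | \<sigma> permutes {..<n}. mscale (\<chi> \<sigma>) (power_sum (cycle_type n \<sigma>)))"
  define G where "G \<sigma> = mscale (\<chi> \<sigma>) (power_sum (cycle_type (Suc n) \<sigma>))" for \<sigma>
  have "partial_deriv (PSum 1) (frobenius (Suc n) \<chi>) = mscale (1 / fact (Suc n)) (\<Sum>\<sigma>\<in>S. partial_deriv (PSum 1) (G \<sigma>))"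
    unfolding frobenius_def S_def[symmetric] G_def[symmetric]
    by (simp only: mpp.linear_scale[OF mlinear_partial_deriv] mpp.linear_sum[OF mlinear_partial_deriv])
  also have "(\<Sum>\<sigma>\<in>S. partial_deriv (PSum 1) (G \<sigma>)) = (\<Sum>\<sigma>\<in>S. \<Sum>i<Suc n. if \<sigma> i = i then F \<sigma> else 0)"
    unfolding G_def by (intro sum.cong refl deriv)
  also have "\<dots> = (\<Sum>i<Suc n. Z)"
    unfolding Z_def by (subst sum.swap) (intro sum.cong refl inner, simp)
  also have "\<dots> = mscale (of_nat (Suc n)) Z"
    by (simp only: sum_constant card_lessThan mscale_def Const_def single_of_nat)
  also have "mscale (1 / fact (Suc n)) \<dots> = frobenius n \<chi>"
  proof -
    have "1 / fact (Suc n) * of_nat (Suc n) = (1 / fact n :: rat)"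
      by (simp add: field_simps del: of_nat_Suc)
    thus ?thesis by (simp only: mp.scale_scale frobenius_def Z_def)
  qed
  finally show ?thesis .
qed

lemma frobenius_cong:
  "(\<And>\<sigma>. \<sigma> permutes {..<n} \<Longrightarrow> \<chi> \<sigma> = \<psi> \<sigma>) \<Longrightarrow> frobenius n \<chi> = frobenius n \<psi>"
  unfolding frobenius_def by (intro arg_cong[of _ _ "mscale _"] sum.cong) auto

lemma frobenius_sum: "frobenius n (\<lambda>\<sigma>. \<Sum>i\<in>I. \<chi> i \<sigma>) = (\<Sum>i\<in>I. frobenius n (\<chi> i))"
  unfolding frobenius_def mp.scale_sum_left
  by (subst sum.swap) (simp add: mp.scale_sum_right)

lemma frobenius_zero: "frobenius n (\<lambda>\<sigma>. 0) = 0"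
  by (simp add: frobenius_def)

section \<open>Rectangles\<close>

lemma finite_dim_keys_bounded:
  assumes "finite_dim W"
  obtains U where "finite U" "\<And>P. P \<in> W \<Longrightarrow> Poly_Mapping.keys P \<subseteq> U"
proof -
  obtain S where S: "finite S" "W \<subseteq> mp.span S" using assms by (auto simp: finite_dim_def)
  define U where "U = (\<Union>P\<in>S. Poly_Mapping.keys P)"
  have "mp.subspace {P. Poly_Mapping.keys P \<subseteq> U}"
  proof (rule mp.subspaceI; clarify)
    fix P Q :: "'a mpoly" and m
    assume "Poly_Mapping.keys P \<subseteq> U" "Poly_Mapping.keys Q \<subseteq> U" "m \<in> Poly_Mapping.keys (P + Q)"
    thus "m \<in> U" using subsetD[OF keys_add[of P Q]] by blast
  qed (auto simp: in_keys_iff)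
  hence "mp.span S \<subseteq> {P. Poly_Mapping.keys P \<subseteq> U}"
    by (intro mp.span_minimal) (auto simp: U_def)
  thus ?thesis using that[of U] S by (auto simp: U_def)
qed

text \<open>Only finitely many monomials occur in a finite-dimensional space, and the sum of all
  their degrees bounds each of them.\<close>

lemma bihom_part_eventually_zero:
  assumes "finite_dim W" "mp.subspace W"
  obtains K where "\<And>h k. K \<le> h \<or> K \<le> k \<Longrightarrow> bihom_part h k W = {0}"
proof -
  obtain U where U: "finite U" "\<And>P. P \<in> W \<Longrightarrow> Poly_Mapping.keys P \<subseteq> U"
    using finite_dim_keys_bounded[OF assms(1)] by blast
  define K where "K = Suc (\<Sum>m\<in>U. xdegree m + ydegree m)"
  have "bihom_part h k W = {0}" if hk: "K \<le> h \<or> K \<le> k" for h k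
  proof -
    have "P = 0" if "P \<in> bihom_part h k W" for P
    proof (rule ccontr)
      assume "P \<noteq> 0"
      then obtain m where "Poly_Mapping.lookup P m \<noteq> 0" by (metis poly_mapping_eqI lookup_zero)
      hence m: "m \<in> Poly_Mapping.keys P" by (simp add: in_keys_iff)
      hence "m \<in> U" using U(2) that by (auto simp: bihom_part_def)
      hence "xdegree m + ydegree m < K"
        using member_le_sum[of m U "\<lambda>m. xdegree m + ydegree m"] U(1) by (simp add: K_def)
      thus False using hk m that by (auto simp: bihom_part_def bihomogeneous_def)
    qed
    thus ?thesis using mp.subspace_0[OF subspace_bihom_part[OF assms(2)], of h k] by auto
  qed
  thus ?thesis by (rule that)
qed

lemma subspace_deriv_module: "mp.subspace (deriv_module \<mu>)"
  by (simp add: deriv_module_def)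

text \<open>The finite index set is left free because boxes of different sizes are needed after
  shifting by a cell.\<close>

lemma frob_char_eq_sum:
  assumes K: "\<And>h k. K \<le> h \<or> K \<le> k \<Longrightarrow> bihom_part h k (deriv_module \<mu>) = {0}"
    and A: "finite A" "{..<K} \<times> {..<K} \<subseteq> A"
  shows "frob_char \<mu>
    = (\<Sum>(h, k)\<in>A. Var TVar ^ h * Var QVar ^ k * frobenius (sum_list \<mu>) (bichar \<mu> h k))"
  unfolding frob_char_def
proof (rule Sum_any.expand_superset[OF A(1)], rule subsetI, rule ccontr)
  fix c assume c: "c \<in> {c. (case c of (h, k) \<Rightarrow> Var TVar ^ h * Var QVar ^ k * frobenius (sum_list \<mu>) (bichar \<mu> h k)) \<noteq> 0}"
    and "c \<notin> A"
  obtain h k where hk: "c = (h, k)" by (cases c)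
  have "K \<le> h \<or> K \<le> k" using \<open>c \<notin> A\<close> subsetD[OF A(2), of c] by (auto simp: hk intro: leI)
  hence "bichar \<mu> h k = (\<lambda>\<sigma>. 0)" by (simp add: bichar_def fun_eq_iff K)
  thus False using c by (simp add: hk frobenius_zero)
qed

text \<open>The action of \<open>\<tau>\<close> maps the bihomogeneous part onto itself and
  intertwines the actions of \<open>\<sigma>\<close> and of its conjugate.\<close>

lemma bichar_involution_conj:
  assumes fin: "finite_dim (deriv_module \<mu>)"
    and \<sigma>: "\<sigma> permutes {..<sum_list \<mu>}" and \<tau>: "\<tau> permutes {..<sum_list \<mu>}" "\<tau> \<circ> \<tau> = id"
  shows "bichar \<mu> h k (\<tau> \<circ> \<sigma> \<circ> \<tau>) = bichar \<mu> h k \<sigma>"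
proof -
  define W where "W = bihom_part h k (deriv_module \<mu>)"
  have bij: "bij \<sigma>" "bij \<tau>" using permutes_bij \<sigma> \<tau>(1) by blast+
  have inv: "diag_action \<rho> ` W \<subseteq> W" if "\<rho> permutes {..<sum_list \<mu>}" for \<rho>
    using that unfolding W_def deriv_module_bimodule
    by (intro diag_action_bihom_part diag_action_bimodule permutes_bij)
      (auto simp: length_biexponents)
  have tau_tau: "diag_action \<tau> (diag_action \<tau> P) = P" for P
    by (simp add: diag_action_comp bij \<tau>(2) diag_action_id)
  have image: "diag_action \<tau> ` W = W"
  proof
    show "W \<subseteq> diag_action \<tau> ` W"
    proof
      fix P assume "P \<in> W"
      hence "diag_action \<tau> P \<in> W" using inv[OF \<tau>(1)] by blast
      thus "P \<in> diag_action \<tau> ` W" by (rule image_eqI[rotated]) (simp add: tau_tau)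
    qed
  qed (rule inv[OF \<tau>(1)])
  have "trace_on (diag_action \<tau> ` W) (diag_action (\<tau> \<circ> \<sigma> \<circ> \<tau>)) = trace_on W (diag_action \<sigma>)"
  proof (rule trace_on_conj)
    show "mp.subspace W" unfolding W_def by (intro subspace_bihom_part subspace_deriv_module)
    show "finite_dim W" by (rule finite_dim_subset[OF fin]) (auto simp: W_def bihom_part_def)
    show "diag_action \<sigma> ` W \<subseteq> W" by (rule inv[OF \<sigma>])
    fix P
    have "\<tau> \<circ> \<sigma> \<circ> \<tau> \<circ> \<tau> = \<tau> \<circ> \<sigma>" by (simp add: comp_assoc \<tau>(2))
    thus "diag_action \<tau> (diag_action \<sigma> P) = diag_action (\<tau> \<circ> \<sigma> \<circ> \<tau>) (diag_action \<tau> P)"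
      by (simp add: diag_action_comp bij bij_comp)
    show "P = 0" if "diag_action \<tau> P = 0"
      using that tau_tau[of P] mpp.linear_0[OF mlinear_diag_action[OF bij(2)]] by simp
  qed (auto intro: mlinear_diag_action bij bij_comp)
  thus ?thesis by (simp add: bichar_def image flip: W_def)
qed

text \<open>Within a row the second coordinate increases, and a later row has a larger first
  coordinate.\<close>

lemma sorted_wrt_biexponents:
  "sorted_wrt (\<lambda>c d. \<not> (fst d \<le> fst c \<and> snd d \<le> snd c)) (biexponents \<mu>)"
proof -
  have "sorted_wrt (\<lambda>c d. \<not> (fst d \<le> fst c \<and> snd d \<le> snd c)) (concat (map (\<lambda>p. map (Pair p) [0..<f p]) [0..<n]))"
    for n and f :: "nat \<Rightarrow> nat"
  proof (induction n)
    case (Suc n)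
    have "sorted_wrt (\<lambda>x y. \<not> y \<le> x) [0..<f n]"
      using sorted_wrt_upt[of 0 "f n"] by (simp add: not_le)
    thus ?case using Suc by (auto simp: sorted_wrt_append sorted_wrt_map)
  qed simp
  thus ?thesis by (simp add: biexponents_def)
qed

text \<open>The corner is the last cell in lexicographic order, so removing it only deletes the last
  entry.\<close>

lemma biexponents_rectangle:
  assumes "r \<ge> 1" "s \<ge> 1"
  shows "biexponents (rectangle r s) = biexponents (rectangle_minus_corner r s) @ [(s - 1, r - 1)]"
proof -
  obtain r' s' where rs: "r = Suc r'" "s = Suc s'" using assms by (metis Suc_le_D One_nat_def)
  define rows where "rows = concat (map (\<lambda>p. map (Pair p) [0..<r]) [0..<s'])"
  have "biexponents (rectangle r s) = concat (map (\<lambda>p. map (Pair p) [0..<r]) [0..<s])"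
    unfolding biexponents_def rectangle_def
    by (intro arg_cong[of _ _ concat] map_cong) auto
  hence rect: "biexponents (rectangle r s) = rows @ map (Pair s') [0..<r'] @ [(s', r')]"
    by (simp add: rs rows_def)
  have "biexponents (rectangle_minus_corner r s) = rows @ map (Pair s') [0..<r']"
  \<comment> \<open>For a single column the last row becomes empty and is absent from the list of
    parts.\<close>
  proof (cases "r' = 0")
    case True
    have "biexponents (rectangle_minus_corner r s) = rows"
      unfolding biexponents_def rectangle_minus_corner_def rows_def using True
      by (intro arg_cong[of _ _ concat] map_cong) (auto simp: rs)
    thus ?thesis using True by simp
  next
    case False
    have "biexponents (rectangle_minus_corner r s)
      = concat (map (\<lambda>p. map (Pair p) [0..<(if p < s' then r else r')]) [0..<Suc s'])"
      unfolding biexponents_def rectangle_minus_corner_def using False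
      by (intro arg_cong[of _ _ concat] map_cong) (auto simp: rs nth_append)
    also have "\<dots> = rows @ map (Pair s') [0..<r']"
      unfolding rows_def by (auto intro!: arg_cong[of _ _ concat])
    finally show ?thesis .
  qed
  thus ?thesis using rect by (simp add: rs)
qed

lemma partial_deriv_biexponent_gen_mult:
  "partial_deriv (PSum i) (biexponent_gen \<mu> * P) = biexponent_gen \<mu> * partial_deriv (PSum i) P"
proof -
  have "partial_deriv (PSum i) (\<Sum>(p, q)\<leftarrow>cs. Var TVar ^ p * Var QVar ^ q) = 0" for cs
    by (induction cs)
      (auto simp: mpp.linear_0[OF mlinear_partial_deriv] mpp.linear_add[OF mlinear_partial_deriv]
        partial_deriv_mult partial_deriv_Var_power)
  thus ?thesis by (simp add: biexponent_gen_def partial_deriv_mult)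
qed

lemma partial_deriv_funpow_biexponent_gen_mult:
  "(partial_deriv (PSum i) ^^ n) (biexponent_gen \<mu> * P) = biexponent_gen \<mu> * (partial_deriv (PSum i) ^^ n) P"
  by (induction n) (simp_all add: partial_deriv_biexponent_gen_mult)

lemma sum_shift_box:
  fixes T :: "nat \<Rightarrow> nat \<Rightarrow> 'a :: comm_monoid_add"
  shows "(\<Sum>(h, k)\<in>{..<K} \<times> {..<K}. if a \<le> h \<and> b \<le> k then T h k else 0)
    = (\<Sum>(h, k)\<in>{..<K - a} \<times> {..<K - b}. T (h + a) (k + b))"
proof -
  have "(\<Sum>(h, k)\<in>{..<K} \<times> {..<K}. if a \<le> h \<and> b \<le> k then T h k else 0)
      = (\<Sum>c\<in>{c \<in> {..<K} \<times> {..<K}. a \<le> fst c \<and> b \<le> snd c}. T (fst c) (snd c))"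
    unfolding case_prod_unfold by (rule sum.inter_filter[symmetric]) simp
  also have "\<dots> = (\<Sum>(h, k)\<in>{..<K - a} \<times> {..<K - b}. T (h + a) (k + b))"
    by (rule sum.reindex_bij_witness[of _ "\<lambda>(h, k). (h + a, k + b)" "\<lambda>(h, k). (h - a, k - b)"]) auto
  finally show ?thesis .
qed

theorem theorem1p1:
  fixes r s :: nat
  assumes "r \<ge> 1" and "s \<ge> 1" and "r * s \<ge> 2"
    and "mp.dim (deriv_module (rectangle_minus_corner r s)) = fact (r * s - 1)"
  shows "mp.dim (deriv_module (rectangle r s)) = fact (r * s)
    \<and> partial_deriv (PSum 1) (frob_char (rectangle r s))
        = biexponent_gen (rectangle r s) * frob_char (rectangle_minus_corner r s)
    \<and> hilbert_series (rectangle r s)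
        = biexponent_gen (rectangle r s) * hilbert_series (rectangle_minus_corner r s)"
proof -
  let ?\<mu> = "rectangle r s" and ?\<nu> = "rectangle_minus_corner r s"
  define n where "n = r * s - 1"
  define E where "E = biexponents ?\<mu>"
  define E' where "E' = biexponents ?\<nu>"
  have E_eq: "E = E' @ [(s - 1, r - 1)]"
    unfolding E_def E'_def by (rule biexponents_rectangle[OF assms(1,2)])
  have sum_\<mu>: "sum_list ?\<mu> = Suc n"
    using assms(3) by (simp add: rectangle_def sum_list_replicate n_def mult.commute)
  have len: "length E = Suc n" by (simp add: E_def length_biexponents sum_\<mu>)
  have sum_\<nu>: "sum_list ?\<nu> = n"
    using len length_biexponents[of ?\<nu>] by (simp add: E_eq flip: E'_def)
  have set_E: "set E = {..s - 1} \<times> {..r - 1}"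
    using assms(1,2) by (auto simp: E_def set_biexponents rectangle_def)
  interpret rectangle_extension_fact E E' "s - 1" "r - 1" n
  proof
    show "E = E' @ [(s - 1, r - 1)]" by (rule E_eq)
    show "n = length E'" using len by (simp add: E_eq)
    show "distinct E" by (simp add: E_def distinct_biexponents)
    show "set E = {..s - 1} \<times> {..r - 1}" by (rule set_E)
    show "sorted_wrt (\<lambda>c d. \<not> (fst d \<le> fst c \<and> snd d \<le> snd c)) E"
      unfolding E_def by (rule sorted_wrt_biexponents)
    show "mp.dim (bimodule E') = fact n"
      using assms(4) by (simp add: E'_def n_def deriv_module_bimodule)
  qed
  have mod_\<mu>: "deriv_module ?\<mu> = bimodule E" and mod_\<nu>: "deriv_module ?\<nu> = bimodule E'"
    by (simp_all add: deriv_module_bimodule E_def E'_def)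
  have dim: "mp.dim (deriv_module ?\<mu>) = fact (r * s)"
  proof -
    have "Suc n = r * s" using assms(3) by (simp add: n_def)
    thus ?thesis using dim_E_image_filt(1) by (simp only: mod_\<mu>)
  qed

  have fin_\<mu>: "finite_dim (deriv_module ?\<mu>)" unfolding mod_\<mu> by (rule finite_dim_E)
  \<comment> \<open>The bottom layer of the filtration maps onto the smaller module, which thereby
    inherits finite dimension.\<close>
  have "bimodule E' = Dn 0 ` filt (Suc 0)" using dim_E_image_filt(2)[of 0] by simp
  hence fin_\<nu>: "finite_dim (deriv_module ?\<nu>)"
    unfolding mod_\<nu> using finite_dim_image[OF finite_dim_filt mlinear_D] by simp
  obtain K\<mu> where K\<mu>: "\<And>h k. K\<mu> \<le> h \<or> K\<mu> \<le> k \<Longrightarrow> bihom_part h k (deriv_module ?\<mu>) = {0}"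
    using bihom_part_eventually_zero[OF fin_\<mu> subspace_deriv_module] by blast
  obtain K\<nu> where K\<nu>: "\<And>h k. K\<nu> \<le> h \<or> K\<nu> \<le> k \<Longrightarrow> bihom_part h k (deriv_module ?\<nu>) = {0}"
    using bihom_part_eventually_zero[OF fin_\<nu> subspace_deriv_module] by blast
  \<comment> \<open>Large enough that the box, even after shrinking by any cell, contains all
    bidegrees occurring for \<open>?\<nu>\<close>.\<close>
  define K where "K = K\<mu> + K\<nu> + r + s"
  define t :: "nat \<Rightarrow> nat \<Rightarrow> symvar mpoly" where "t h k = Var TVar ^ h * Var QVar ^ k" for h k
  define G where "G h k = frobenius n (bichar ?\<nu> h k)" for h k
  have t_add: "t (h + h') (k + k') = t h' k' * t h k" for h h' k k'
    by (simp add: t_def power_add mult_ac)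
  have frob_\<nu>: "frob_char ?\<nu> = (\<Sum>(h, k)\<in>{..<K - a} \<times> {..<K - b}. t h k * G h k)" if "(a, b) \<in> set E" for a b
  proof -
    have "a \<le> s" "b \<le> r" using that by (auto simp: set_E)
    hence "{..<K\<nu>} \<times> {..<K\<nu>} \<subseteq> {..<K - a} \<times> {..<K - b}" by (auto simp: K_def)
    from frob_char_eq_sum[OF K\<nu> _ this] show ?thesis by (simp add: t_def G_def sum_\<nu>)
  qed
  have frob_\<mu>: "frob_char ?\<mu> = (\<Sum>(h, k)\<in>{..<K} \<times> {..<K}. t h k * frobenius (Suc n) (bichar ?\<mu> h k))"
  proof -
    have "{..<K\<mu>} \<times> {..<K\<mu>} \<subseteq> {..<K} \<times> {..<K}" by (auto simp: K_def)
    from frob_char_eq_sum[OF K\<mu> _ this] show ?thesis by (simp add: t_def sum_\<mu>)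
  qed
  \<comment> \<open>Here the character of \<open>?\<mu>\<close> is evaluated only on permutations
    fixing the last index, where the trace formula applies.\<close>
  have restrict: "frobenius n (bichar ?\<mu> h k)
      = (\<Sum>(a, b)\<in>set E. if a \<le> h \<and> b \<le> k then G (h - a) (k - b) else 0)" for h k
  proof -
    have "bichar ?\<mu> h k \<sigma> = (\<Sum>c\<in>set E. if fst c \<le> h \<and> snd c \<le> k then bichar ?\<nu> (h - fst c) (k - snd c) \<sigma> else 0)"
      if "\<sigma> permutes {..<n}" for \<sigma>
      using trace_bihom_part[OF that, of h k] distinct_E
      by (simp add: bichar_def mod_\<mu> mod_\<nu> sum_list_distinct_conv_sum_set cong: if_cong)
    hence "frobenius n (bichar ?\<mu> h k)
      = (\<Sum>c\<in>set E. frobenius n (\<lambda>\<sigma>. if fst c \<le> h \<and> snd c \<le> k then bichar ?\<nu> (h - fst c) (k - snd c) \<sigma> else 0))"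
      unfolding frobenius_sum[symmetric] by (rule frobenius_cong)
    also have "\<dots> = (\<Sum>(a, b)\<in>set E. if a \<le> h \<and> b \<le> k then G (h - a) (k - b) else 0)"
      by (intro sum.cong refl) (auto simp: G_def frobenius_zero)
    finally show ?thesis .
  qed
  have frob: "partial_deriv (PSum 1) (frob_char ?\<mu>) = biexponent_gen ?\<mu> * frob_char ?\<nu>"
  proof -
    have deriv: "partial_deriv (PSum 1) (t h k * frobenius (Suc n) (bichar ?\<mu> h k))
        = (\<Sum>(a, b)\<in>set E. if a \<le> h \<and> b \<le> k then t h k * G (h - a) (k - b) else 0)" for h k
    proof -
      have "partial_deriv (PSum 1) (frobenius (Suc n) (bichar ?\<mu> h k)) = frobenius n (bichar ?\<mu> h k)"
        by (rule partial_deriv_frobenius, rule bichar_involution_conj[OF fin_\<mu>]) (simp_all add: sum_\<mu>)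
      thus ?thesis
        unfolding t_def
        by (subst partial_deriv_Var_power_mult)
          (auto simp: restrict sum_distrib_left case_prod_unfold intro!: sum.cong)
    qed
    have "partial_deriv (PSum 1) (frob_char ?\<mu>)
        = (\<Sum>(h, k)\<in>{..<K} \<times> {..<K}. \<Sum>(a, b)\<in>set E. if a \<le> h \<and> b \<le> k then t h k * G (h - a) (k - b) else 0)"
      unfolding frob_\<mu> mpp.linear_sum[OF mlinear_partial_deriv]
      by (intro sum.cong refl) (auto simp only: deriv split: prod.split)
    \<comment> \<open>For a fixed cell, the sum over bidegrees is a shifted copy of the series of
      \<open>?\<nu>\<close> from which the monomial \<open>t a b\<close> splits off.\<close>
    also have "\<dots> = (\<Sum>(a, b)\<in>set E. \<Sum>(h, k)\<in>{..<K} \<times> {..<K}. if a \<le> h \<and> b \<le> k then t h k * G (h - a) (k - b) else 0)"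
      unfolding case_prod_unfold by (rule sum.swap)
    also have "\<dots> = (\<Sum>(a, b)\<in>set E. t a b * frob_char ?\<nu>)"
    proof (intro sum.cong refl, clarify)
      fix a b assume ab: "(a, b) \<in> set E"
      show "(\<Sum>(h, k)\<in>{..<K} \<times> {..<K}. if a \<le> h \<and> b \<le> k then t h k * G (h - a) (k - b) else 0) = t a b * frob_char ?\<nu>"
        unfolding sum_shift_box frob_\<nu>[OF ab] sum_distrib_left
        by (intro sum.cong refl) (auto simp: t_add mult.assoc)
    qed
    also have "\<dots> = biexponent_gen ?\<mu> * frob_char ?\<nu>"
      by (simp add: biexponent_gen_def sum_list_distinct_conv_sum_set[OF distinct_E] sum_distrib_right
          t_def case_prod_unfold flip: E_def)
    finally show ?thesis .
  qed
  \<comment> \<open>Of the n + 1 derivatives the innermost is given by \<open>frob\<close>; the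
    other n pass through the cell generating function, which contains no power sums.\<close>
  have "hilbert_series ?\<mu> = (partial_deriv (PSum 1) ^^ n) (partial_deriv (PSum 1) (frob_char ?\<mu>))"
    by (simp add: hilbert_series_def sum_\<mu> funpow_swap1)
  also have "\<dots> = biexponent_gen ?\<mu> * hilbert_series ?\<nu>"
    unfolding frob partial_deriv_funpow_biexponent_gen_mult by (simp add: hilbert_series_def sum_\<nu>)
  finally show ?thesis using dim frob by blast
qed

end
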